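(* Let $\mathcal{D}$ be a PDF-bounded distribution on $[0,1]$, and let $C\ge 1$ be an arbitrary constant. Consider $n$ agents and $m$ items, with each utility $u_i(g)$ drawn independently from $\mathcal{D}$. For any weight vector $(w_1,\ldots,w_n)$ of positive reals with $w_{\max}/w_{\min}\le C$, if $m=\Omega(n\log n/\log\log n)$, then the allocation produced by the weighted picking sequence algorithm is weighted envy-free (WEF) with high probability, i.e., with probability tending to $1$ as $n\to\infty$.
   Context: Agents $N=[n]$ with positive weights $w_i$; items $M=[m]$. Each agent $i$ has an additive utility $u_i(S)=\sum_{g\in S}u_i(g)$; each $u_i(g)$ is drawn independently from a distribution $\mathcal{D}$ over $[0,1]$. $w_{\max},w_{\min}$ denote the maximum and minimum weights. A distribution $\mathcal{D}$ is $(\alpha,\beta)$-PDF-bounded if it is non-atomic and its density $f_{\mathcal{D}}$ satisfies $\alpha\le f_{\mathcal{D}}(x)\le\beta$ for all $x\in[0,1]$; it is PDF-bounded if this holds for some constants $\alpha,\beta>0$. An allocation $(A_1,\ldots,A_n)$ (a partition of $M$) is WEF if $u_i(A_i)/w_i\ge u_i(A_j)/w_j$ for all $i,j\in N$. The weighted picking sequence algorithm: start with $A_i=\emptyset$, $t_i=0$ for all $i$; while items remain, pick an agent $i^*$ minimizing $t_i/w_i$ (ties broken arbitrarily), let $i^*$ take an item of maximum utility to her among the remaining items, and increase $t_{i^*}$ by $1$. *)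

theory Defs
  imports "HOL-Probability.Probability"
begin

definition pdf_bounded :: "(real \<Rightarrow> real) \<Rightarrow> bool" where
  "pdf_bounded f \<longleftrightarrow>
     f \<in> borel_measurable lborel \<and>
     (\<forall>x. x \<notin> {0..1} \<longrightarrow> f x = 0) \<and>
     (\<exists>\<alpha> \<beta>. 0 < \<alpha> \<and> 0 < \<beta> \<and> (\<forall>x\<in>{0..1}. \<alpha> \<le> f x \<and> f x \<le> \<beta>)) \<and>
     (\<integral>\<^sup>+ x. ennreal (f x) \<partial>lborel) = 1"

definition dist_of :: "(real \<Rightarrow> real) \<Rightarrow> real measure" where
  "dist_of f = density lborel (\<lambda>x. ennreal (f x))"

definition util_space :: "(real \<Rightarrow> real) \<Rightarrow> nat \<Rightarrow> nat \<Rightarrow> ((nat \<times> nat) \<Rightarrow> real) measure" where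
  "util_space f n m = PiM ({..<n} \<times> {..<m}) (\<lambda>_. dist_of f)"

definition util_of :: "((nat \<times> nat) \<Rightarrow> real) \<Rightarrow> nat \<Rightarrow> nat \<Rightarrow> real" where
  "util_of \<omega> i g = \<omega> (i, g)"

text \<open>Reachable states of the weighted picking sequence algorithm (agents 0..n-1,
  items 0..m-1, weights w, utilities u). A state is the partial allocation A;
  t_i = card (A i). All tie-breaking choices are allowed (nondeterminism).\<close>
inductive wps_reach :: "nat \<Rightarrow> nat \<Rightarrow> (nat \<Rightarrow> real) \<Rightarrow> (nat \<Rightarrow> nat \<Rightarrow> real) \<Rightarrow> (nat \<Rightarrow> nat set) \<Rightarrow> bool"
  for n m w u where
  init: "wps_reach n m w u (\<lambda>_. {})"
| step: "\<lbrakk> wps_reach n m w u A;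
           i < n;
           \<forall>j<n. real (card (A i)) / w i \<le> real (card (A j)) / w j;
           g \<in> {..<m} - (\<Union>j<n. A j);
           \<forall>h \<in> {..<m} - (\<Union>j<n. A j). u i h \<le> u i g \<rbrakk>
         \<Longrightarrow> wps_reach n m w u (A(i := insert g (A i)))"

definition wps_outcome :: "nat \<Rightarrow> nat \<Rightarrow> (nat \<Rightarrow> real) \<Rightarrow> (nat \<Rightarrow> nat \<Rightarrow> real) \<Rightarrow> (nat \<Rightarrow> nat set) \<Rightarrow> bool" where
  "wps_outcome n m w u A \<longleftrightarrow> wps_reach n m w u A \<and> {..<m} - (\<Union>j<n. A j) = {}"

definition WEF :: "nat \<Rightarrow> (nat \<Rightarrow> real) \<Rightarrow> (nat \<Rightarrow> nat \<Rightarrow> real) \<Rightarrow> (nat \<Rightarrow> nat set) \<Rightarrow> bool" where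
  "WEF n w u A \<longleftrightarrow> (\<forall>i<n. \<forall>j<n. (\<Sum>g\<in>A j. u i g) / w j \<le> (\<Sum>g\<in>A i. u i g) / w i)"

end

theory Submission
  imports Defs "HOL-Real_Asymp.Real_Asymp"
begin

text \<open>
  When agent \<open>j\<close> makes her \<open>r\<close>-th pick, of value \<open>v r\<close> to agent \<open>i\<close>, let \<open>e r \<ge> v r\<close> be the value of the latest
  pick of \<open>i\<close>. The picking rule gives \<open>u i (A i) / w i \<ge> ((\<Sum>r. e r) - 1) / w j\<close>, so envy forces
  \<open>\<Sum>r. (e r - v r) < 1\<close>. As \<open>e\<close> is nonincreasing, the first \<open>t\<close> values \<open>v r\<close> are then close to their running
  maxima from the right, which has probability about \<open>(const / t)^t\<close> for \<open>t\<close> fixed items: this is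
  polynomially small in \<open>n\<close> for \<open>t\<close> of order \<open>ln n / ln (ln n)\<close>.

  Ties may be broken with knowledge of all utilities, so this has to be summed over all possible
  first \<open>t\<close> picks of \<open>j\<close>. The sum stays small because, whatever the tie-breaking, these picks are
  among the \<open>O(ln n)\<close> favourite items of \<open>j\<close>. Otherwise all favourites of \<open>j\<close> were taken early on. Trace this back through
  the set \<open>B\<close> of agents who took one of the relevant items although it was not among their \<open>O(t)\<close> top
  items: the favourites of \<open>j\<close> and the top items of \<open>B\<close> are all gone, but the agents in \<open>B\<close> and \<open>j\<close>
  took only a small part of them, so most of them are top items of other agents. This is exponentially unlikely in
  \<open>ln n + t * card B\<close>, which beats the number of choices of \<open>B\<close> because every agent in \<open>B\<close> must also want a relevant item.
\<close>

section \<open>Bounded densities\<close>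

locale bounded_density =
  fixes f :: "real \<Rightarrow> real" and \<alpha> \<beta> :: real
  assumes f_meas: "f \<in> borel_measurable lborel"
    and f_supp: "\<And>x. x \<notin> {0..1} \<Longrightarrow> f x = 0"
    and \<alpha>_pos: "0 < \<alpha>"
    and f_lower: "\<And>x. x \<in> {0..1} \<Longrightarrow> \<alpha> \<le> f x"
    and f_upper: "\<And>x. x \<in> {0..1} \<Longrightarrow> f x \<le> \<beta>"
    and f_total: "(\<integral>\<^sup>+ x. ennreal (f x) \<partial>lborel) = 1"
begin

abbreviation "D \<equiv> dist_of f"

lemma f_borel [measurable]: "f \<in> borel_measurable borel"
  using f_meas by simp

lemma \<alpha>_le_\<beta>: "\<alpha> \<le> \<beta>"
  using f_lower[of 0] f_upper[of 0] by simp

lemma \<beta>_pos: "0 < \<beta>"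
  using \<alpha>_pos \<alpha>_le_\<beta> by simp

lemma f_le: "f x \<le> \<beta>"
  using f_upper[of x] f_supp[of x] \<beta>_pos by (cases "x \<in> {0..1}") auto

lemma sets_D [simp, measurable_cong]: "sets D = sets borel"
  by (simp add: dist_of_def)

lemma space_D [simp]: "space D = UNIV"
  by (simp add: dist_of_def)

lemma measurable_D [simp]: "measurable D N = measurable borel N" "measurable N D = measurable N borel"
  by (auto intro!: measurable_cong_sets)

lemma prob_space_D: "prob_space D"
  by (rule prob_spaceI) (simp add: dist_of_def emeasure_density f_total)

sublocale D: prob_space D
  by (rule prob_space_D)

lemma nn_integral_D:
  assumes "g \<in> borel_measurable borel"
  shows "(\<integral>\<^sup>+ v. g v \<partial>D) = (\<integral>\<^sup>+ v. ennreal (f v) * g v \<partial>lborel)"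
  unfolding dist_of_def using assms by (subst nn_integral_density) auto

lemma nn_integral_D_le:
  assumes [measurable]: "g \<in> borel_measurable borel"
  shows "(\<integral>\<^sup>+ v. g v \<partial>D) \<le> ennreal \<beta> * (\<integral>\<^sup>+ v. g v \<partial>lborel)"
proof -
  have "(\<integral>\<^sup>+ v. g v \<partial>D) \<le> (\<integral>\<^sup>+ v. ennreal \<beta> * g v \<partial>lborel)"
    by (subst nn_integral_D)
       (auto intro!: nn_integral_mono mult_right_mono ennreal_leI f_le)
  also have "\<dots> = ennreal \<beta> * (\<integral>\<^sup>+ v. g v \<partial>lborel)"
    by (rule nn_integral_cmult) simp
  finally show ?thesis .
qed

lemma \<beta>_ge_1: "1 \<le> \<beta>"
proof -
  have "(\<integral>\<^sup>+ v. ennreal (f v) \<partial>lborel) \<le> (\<integral>\<^sup>+ v. ennreal \<beta> * indicator {0..1::real} v \<partial>lborel)"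
  proof (rule nn_integral_mono)
    fix v :: real show "ennreal (f v) \<le> ennreal \<beta> * indicator {0..1} v"
      using f_supp[of v] f_le[of v] by (cases "v \<in> {0..1}") (auto intro: ennreal_leI)
  qed
  also have "\<dots> = ennreal \<beta>" by (simp add: nn_integral_cmult_indicator)
  finally show ?thesis by (simp add: f_total ennreal_ge_1)
qed

lemma AE_D_unit: "AE v in D. v \<in> {0..1}"
  unfolding dist_of_def
  by (subst AE_density) (use f_supp in \<open>force intro!: AE_I2\<close>)+

text \<open>These bounds turn the thresholds \<open>1 - x\<close> and \<open>1 - y\<close> into
  probabilities. The lower bound gives an agent enough items above a threshold on average, and the
  upper bound keeps such values rare for any single item.\<close>

lemma D_upper_tail:
  assumes "0 \<le> x" "x \<le> 1"
  shows "D.prob {1-x<..} \<le> \<beta> * x" "\<alpha> * x \<le> D.prob {1-x<..}"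
proof -
  have eq: "emeasure D {1-x<..} = (\<integral>\<^sup>+ v. ennreal (f v) * indicator {1-x<..1} v \<partial>lborel)"
    unfolding dist_of_def
    by (subst emeasure_density) (auto intro!: nn_integral_cong simp: indicator_def f_supp)
  have "emeasure D {1-x<..} \<le> (\<integral>\<^sup>+ v. ennreal \<beta> * indicator {1-x<..1} v \<partial>lborel)"
    unfolding eq by (intro nn_integral_mono mult_right_mono ennreal_leI f_le) auto
  also have "\<dots> = ennreal (\<beta> * x)"
    using assms \<beta>_pos by (simp add: nn_integral_cmult_indicator ennreal_mult)
  finally show "D.prob {1-x<..} \<le> \<beta> * x"
    using assms \<beta>_pos by (simp add: D.emeasure_eq_measure)
  have "ennreal (\<alpha> * x) = (\<integral>\<^sup>+ v. ennreal \<alpha> * indicator {1-x<..1} v \<partial>lborel)"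
    using assms \<alpha>_pos by (simp add: nn_integral_cmult_indicator ennreal_mult)
  also have "\<dots> \<le> emeasure D {1-x<..}"
    unfolding eq using assms
    by (intro nn_integral_mono) (auto simp: indicator_def intro!: ennreal_leI f_lower)
  finally show "\<alpha> * x \<le> D.prob {1-x<..}"
    by (simp add: D.emeasure_eq_measure)
qed

end

text \<open>Each side of \<open>c\<close> contributes an exponential integral of
  \<open>1 / \<theta>\<close>. Since the bound does not depend on \<open>c\<close>, the centre may
  later be any function of the other coordinates.\<close>

lemma nn_integral_exp_abs_le:
  assumes "\<theta> > (0::real)"
  shows "(\<integral>\<^sup>+ v. ennreal (exp (- \<theta> * \<bar>v - c\<bar>)) \<partial>lborel) \<le> ennreal (2 / \<theta>)"
proof -
  have half: "(\<integral>\<^sup>+ v. ennreal (exp (- \<theta> * v)) * indicator {0..} v \<partial>lborel) = ennreal (1 / \<theta>)"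
  proof -
    have "(\<integral>\<^sup>+ v. ennreal (exp (- \<theta> * v)) * indicator {0..} v \<partial>lborel)
        = ennreal (0 - (- exp (- \<theta> * 0) / \<theta>))"
    proof (rule nn_integral_FTC_atLeast)
      show "((\<lambda>v. - exp (- \<theta> * v) / \<theta>) \<longlongrightarrow> 0) at_top"
        using assms by real_asymp
    qed (use assms in \<open>auto intro!: derivative_eq_intros\<close>)
    thus ?thesis by simp
  qed
  have half': "(\<integral>\<^sup>+ v. ennreal (exp (\<theta> * v)) * indicator {..0} v \<partial>lborel) = ennreal (1 / \<theta>)"
  proof -
    have "(\<integral>\<^sup>+ v. ennreal (exp (\<theta> * v)) * indicator {..0} v \<partial>lborel)
       = ennreal \<bar>-1\<bar> * (\<integral>\<^sup>+ v. ennreal (exp (\<theta> * (0 + (-1) * v))) * indicator {..0} (0 + (-1) * v) \<partial>lborel)"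
      by (rule nn_integral_real_affine) auto
    also have "\<dots> = (\<integral>\<^sup>+ v. ennreal (exp (- \<theta> * v)) * indicator {0..} v \<partial>lborel)"
      by (auto intro!: nn_integral_cong simp: indicator_def)
    finally show ?thesis using half by simp
  qed
  have "(\<integral>\<^sup>+ v. ennreal (exp (- \<theta> * \<bar>v - c\<bar>)) \<partial>lborel)
      = ennreal \<bar>1\<bar> * (\<integral>\<^sup>+ v. ennreal (exp (- \<theta> * \<bar>(c + 1 * v) - c\<bar>)) \<partial>lborel)"
    by (rule nn_integral_real_affine) auto
  also have "\<dots> = (\<integral>\<^sup>+ v. ennreal (exp (- \<theta> * \<bar>v\<bar>)) \<partial>lborel)"
    by simp
  also have "\<dots> \<le> (\<integral>\<^sup>+ v. ennreal (exp (- \<theta> * v)) * indicator {0..} v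
                    + ennreal (exp (\<theta> * v)) * indicator {..0} v \<partial>lborel)"
    by (intro nn_integral_mono) (auto simp: indicator_def)
  also have "\<dots> = ennreal (1 / \<theta>) + ennreal (1 / \<theta>)"
    using half half' by (subst nn_integral_add) auto
  also have "\<dots> = ennreal (2 / \<theta>)"
    using assms by (simp flip: ennreal_plus)
  finally show ?thesis .
qed

context bounded_density
begin

lemma D_exp_abs_le:
  assumes "\<theta> > (0::real)"
  shows "(\<integral>\<^sup>+ v. ennreal (exp (- \<theta> * \<bar>v - c\<bar>)) \<partial>D) \<le> ennreal (2 * \<beta> / \<theta>)"
proof -
  have "(\<integral>\<^sup>+ v. ennreal (exp (- \<theta> * \<bar>v - c\<bar>)) \<partial>D)
      \<le> ennreal \<beta> * (\<integral>\<^sup>+ v. ennreal (exp (- \<theta> * \<bar>v - c\<bar>)) \<partial>lborel)"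
    by (rule nn_integral_D_le) simp
  also have "\<dots> \<le> ennreal \<beta> * ennreal (2 / \<theta>)"
    using assms by (intro mult_left_mono nn_integral_exp_abs_le) auto
  also have "\<dots> = ennreal (2 * \<beta> / \<theta>)"
    using \<beta>_pos assms by (simp flip: ennreal_mult)
  finally show ?thesis .
qed

lemma product_sigma_finite_D: "product_sigma_finite (\<lambda>_. D)"
  by (intro product_sigma_finite.intro prob_space_imp_sigma_finite prob_space_D)

end

section \<open>Prediction errors along a list of picks\<close>

text \<open>Lists run from the first pick to the last, so every value is predicted from the later
  picks. The head's own value never enters a prediction, which allows it to be integrated out
  first.\<close>

fun dev :: "(real list \<Rightarrow> real) \<Rightarrow> real list \<Rightarrow> real" where
  "dev p [] = 0"
| "dev p (v # vs) = \<bar>v - p vs\<bar> + dev p vs"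

definition next_or :: "real \<Rightarrow> real list \<Rightarrow> real" where
  "next_or c vs = (case vs of [] \<Rightarrow> c | v # _ \<Rightarrow> v)"

definition max_list0 :: "real list \<Rightarrow> real" where
  "max_list0 vs = foldr max vs 0"

text \<open>Along a nonincreasing list all differences have the same sign and telescope. The default
  \<open>c\<close> is the prediction for the last entry.\<close>

lemma dev_next_or:
  assumes "sorted_wrt (\<ge>) vs" "\<And>v. v \<in> set vs \<Longrightarrow> c \<le> v"
  shows "dev (next_or c) vs = next_or c vs - c"
  using assms by (induction vs) (auto simp: next_or_def split: list.splits)

lemma max_list0_ub: "(\<And>v. v \<in> set vs \<Longrightarrow> v \<le> c) \<Longrightarrow> 0 \<le> c \<Longrightarrow> max_list0 vs \<le> c"
  by (induction vs) (auto simp: max_list0_def)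

text \<open>Let \<open>M\<close> be the maximum of the later values. If \<open>v \<ge> M\<close>,
  the error \<open>v - M\<close> is the growth of the running maximum. If \<open>v < M\<close>, the
  error is at most \<open>x - v\<close>, because the nonincreasing \<open>xs\<close> dominates the
  values and hence \<open>x \<ge> M\<close>.\<close>

lemma dev_max_list0:
  assumes "list_all2 (\<lambda>v x. 0 \<le> v \<and> v \<le> x) vs xs" "sorted_wrt (\<ge>) xs"
  shows "dev max_list0 vs \<le> max_list0 vs + (sum_list xs - sum_list vs)"
  using assms
proof (induction vs xs rule: list_all2_induct)
  case Nil
  thus ?case by (simp add: max_list0_def)
next
  case (Cons v vs x xs)
  have "u \<le> x" if "u \<in> set vs" for u
  proof -
    from that obtain k where "k < length vs" "vs ! k = u" by (auto simp: in_set_conv_nth)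
    moreover have "vs ! k \<le> xs ! k" "length xs = length vs"
      using Cons.hyps(2) \<open>k < length vs\<close> by (auto simp: list_all2_conv_all_nth)
    ultimately have "u \<le> xs ! k" "xs ! k \<in> set xs" by auto
    thus ?thesis using Cons.prems by fastforce
  qed
  hence "max_list0 vs \<le> x"
    using Cons.hyps(1) by (intro max_list0_ub) auto
  moreover have "max_list0 (v # vs) = max v (max_list0 vs)"
    by (simp add: max_list0_def)
  ultimately show ?case
    using Cons.IH Cons.prems Cons.hyps(1) by auto
qed

text \<open>Fubini with coordinate \<open>c\<close> innermost. The factor \<open>k\<close> may
  depend on all coordinates, provided its integral over \<open>c\<close> is at most \<kappa>
  whatever the others are; \<open>h\<close> is constant in \<open>c\<close>, so integrating it over
  that probability space changes nothing.\<close>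

lemma nn_integral_PiM_peel:
  assumes M: "\<And>i. prob_space (M i)"
    and I: "finite I" "c \<in> I"
    and k [measurable]: "k \<in> borel_measurable (Pi\<^sub>M I M)"
    and h [measurable]: "h \<in> borel_measurable (Pi\<^sub>M I M)"
    and h_indep: "\<And>\<xi> v. h (\<xi>(c := v)) = h \<xi>"
    and k_le: "\<And>\<xi>. (\<integral>\<^sup>+ v. k (\<xi>(c := v)) \<partial>M c) \<le> \<kappa>"
  shows "(\<integral>\<^sup>+ \<xi>. k \<xi> * h \<xi> \<partial>Pi\<^sub>M I M) \<le> \<kappa> * (\<integral>\<^sup>+ \<xi>. h \<xi> \<partial>Pi\<^sub>M I M)"
proof -
  interpret product_sigma_finite M
    by (intro product_sigma_finite.intro prob_space_imp_sigma_finite M)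
  define J where "J = I - {c}"
  have J: "finite J" "c \<notin> J" "I = insert c J" using I by (auto simp: J_def)
  note [measurable] = k[unfolded J(3)] h[unfolded J(3)]
  have upd: "(\<lambda>v. k (\<xi>(c := v))) \<in> borel_measurable (M c)" if "\<xi> \<in> space (Pi\<^sub>M J M)" for \<xi>
    using measurable_comp[OF measurable_component_update[OF that J(2)] k[unfolded J(3)]]
    by (simp add: comp_def)
  have "(\<integral>\<^sup>+ \<xi>. k \<xi> * h \<xi> \<partial>Pi\<^sub>M I M)
      = (\<integral>\<^sup>+ \<xi>. (\<integral>\<^sup>+ v. k (\<xi>(c := v)) * h \<xi> \<partial>M c) \<partial>Pi\<^sub>M J M)"
    unfolding J(3) by (subst product_nn_integral_insert[OF J(1,2)]) (simp_all add: h_indep)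
  also have "\<dots> \<le> (\<integral>\<^sup>+ \<xi>. \<kappa> * h \<xi> \<partial>Pi\<^sub>M J M)"
    by (intro nn_integral_mono) (simp add: upd nn_integral_multc mult_right_mono k_le)
  also have "\<dots> = (\<integral>\<^sup>+ \<xi>. (\<integral>\<^sup>+ v. \<kappa> * h (\<xi>(c := v)) \<partial>M c) \<partial>Pi\<^sub>M J M)"
    by (simp add: h_indep prob_space.emeasure_space_1[OF M])
  also have "\<dots> = (\<integral>\<^sup>+ \<xi>. \<kappa> * h \<xi> \<partial>Pi\<^sub>M I M)"
    unfolding J(3) by (subst product_nn_integral_insert[OF J(1,2)]) simp_all
  also have "\<dots> = \<kappa> * (\<integral>\<^sup>+ \<xi>. h \<xi> \<partial>Pi\<^sub>M I M)"
    by (rule nn_integral_cmult) simp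
  finally show ?thesis .
qed

lemma measurable_dev:
  assumes "\<And>gs. set gs \<subseteq> J \<Longrightarrow> (\<lambda>\<xi>. p (map (X \<xi>) gs)) \<in> borel_measurable M"
    and "\<And>g. g \<in> J \<Longrightarrow> (\<lambda>\<xi>. X \<xi> g) \<in> borel_measurable M"
    and "set gs \<subseteq> J"
  shows "(\<lambda>\<xi>. dev p (map (X \<xi>) gs)) \<in> borel_measurable M"
  using assms(3)
proof (induction gs)
  case (Cons g gs)
  have "(\<lambda>\<xi>. X \<xi> g) \<in> borel_measurable M" "(\<lambda>\<xi>. p (map (X \<xi>) gs)) \<in> borel_measurable M"
    using Cons.prems assms(1,2) by auto
  thus ?case using Cons by (auto intro!: borel_measurable_add borel_measurable_diff borel_measurable_abs)
qed simp

lemma measurable_next_or: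
  assumes "\<And>g. g \<in> J \<Longrightarrow> (\<lambda>\<xi>. X \<xi> g) \<in> borel_measurable M" "set gs \<subseteq> J"
  shows "(\<lambda>\<xi>. next_or c (map (X \<xi>) gs)) \<in> borel_measurable M"
  using assms by (cases gs) (auto simp: next_or_def)

lemma measurable_max_list0:
  assumes "\<And>g. g \<in> J \<Longrightarrow> (\<lambda>\<xi>. X \<xi> g) \<in> borel_measurable M" "set gs \<subseteq> J"
  shows "(\<lambda>\<xi>. max_list0 (map (X \<xi>) gs)) \<in> borel_measurable M"
  using assms(2) 
proof (induction gs)
  case (Cons g gs)
  thus ?case using assms(1) by (auto simp: max_list0_def)
qed (auto simp: max_list0_def)

text \<open>Exponential weight of two prediction errors along the list \<open>gs\<close>: agent \<open>j\<close>'s values are predicted by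
  the next one, agent \<open>i\<close>'s values by the largest later one. Integrating one cell at a time, each
  factor costs only \<open>2 * \<beta> / \<theta>\<close>, whatever the prediction is.\<close>

definition pair_pot :: "real \<Rightarrow> real \<Rightarrow> real \<Rightarrow> nat \<Rightarrow> nat \<Rightarrow> nat list \<Rightarrow> (nat \<times> nat \<Rightarrow> real) \<Rightarrow> real" where
  "pair_pot c \<theta> \<eta> i j gs \<xi> =
     exp (- \<theta> * dev (next_or c) (map (\<lambda>g. \<xi> (j, g)) gs)) *
     exp (- \<eta> * dev max_list0 (map (\<lambda>g. \<xi> (i, g)) gs))"

context bounded_density
begin

lemma measurable_util_component [measurable]:
  "i < n \<Longrightarrow> g < m \<Longrightarrow> (\<lambda>\<xi>. \<xi> (i, g)) \<in> borel_measurable (util_space f n m)"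
  unfolding util_space_def by simp

lemma prob_space_util: "prob_space (util_space f n m)"
  unfolding util_space_def by (rule prob_space_PiM) (rule prob_space_D)

lemma measurable_pair_dev:
  assumes "i < n" "set gs \<subseteq> {..<m}"
  shows "(\<lambda>\<xi>. dev (next_or c) (map (\<lambda>g. \<xi> (i, g)) gs)) \<in> borel_measurable (util_space f n m)"
    "(\<lambda>\<xi>. dev max_list0 (map (\<lambda>g. \<xi> (i, g)) gs)) \<in> borel_measurable (util_space f n m)"
    "(\<lambda>\<xi>. next_or c (map (\<lambda>g. \<xi> (i, g)) gs)) \<in> borel_measurable (util_space f n m)"
    "(\<lambda>\<xi>. max_list0 (map (\<lambda>g. \<xi> (i, g)) gs)) \<in> borel_measurable (util_space f n m)"
  using assms
  by (auto intro!: measurable_dev[where J="{..<m}"] measurable_next_or[where J="{..<m}"]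
        measurable_max_list0[where J="{..<m}"])

lemma measurable_pair_pot:
  assumes "i < n" "j < n" "set gs \<subseteq> {..<m}"
  shows "pair_pot c \<theta> \<eta> i j gs \<in> borel_measurable (util_space f n m)"
proof -
  note [measurable] = measurable_pair_dev(1)[OF assms(2,3), of c] measurable_pair_dev(2)[OF assms(1,3)]
  show ?thesis unfolding pair_pot_def by measurable
qed

text \<open>The cells \<open>(j, g)\<close> and \<open>(i, g)\<close> of the head item are peeled
  off one after the other. Distinctness of \<open>gs\<close> keeps both out of the tail that the
  predictions read, and \<open>i \<noteq> j\<close> keeps agent \<open>i\<close>'s factor
  independent of the cell \<open>(j, g)\<close>.\<close>

lemma nn_integral_pair_pot:
  assumes ij: "i < n" "j < n" "i \<noteq> j" and \<theta>: "\<theta> > 0" and \<eta>: "\<eta> > 0"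
    and gs: "distinct gs" "set gs \<subseteq> {..<m}"
  shows "(\<integral>\<^sup>+ \<xi>. ennreal (pair_pot c \<theta> \<eta> i j gs \<xi>) \<partial>util_space f n m)
       \<le> ennreal ((2 * \<beta> / \<theta>) * (2 * \<beta> / \<eta>)) ^ length gs"
  using gs
proof (induction gs)
  case Nil
  thus ?case by (simp add: pair_pot_def prob_space.emeasure_space_1[OF prob_space_util])
next
  case (Cons g gs)
  let ?P = "util_space f n m"
  define kj where "kj = (\<lambda>\<xi>. ennreal (exp (- \<theta> * \<bar>\<xi> (j, g) - next_or c (map (\<lambda>g. \<xi> (j, g)) gs)\<bar>)))"
  define ki where "ki = (\<lambda>\<xi>. ennreal (exp (- \<eta> * \<bar>\<xi> (i, g) - max_list0 (map (\<lambda>g. \<xi> (i, g)) gs)\<bar>)))"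
  define h where "h = (\<lambda>\<xi>. ennreal (pair_pot c \<theta> \<eta> i j gs \<xi>))"
  have g: "g < m" "g \<notin> set gs" "set gs \<subseteq> {..<m}" using Cons.prems by auto
  have upd: "map (\<lambda>g'. (\<xi>((a, g) := v)) (b, g')) gs = map (\<lambda>g'. \<xi> (b, g')) gs"
    for \<xi> :: "nat \<times> nat \<Rightarrow> real" and a b v
    using g(2) by auto
  note [measurable] = measurable_pair_dev(3)[OF ij(2) g(3), of c] measurable_pair_dev(4)[OF ij(1) g(3)]
    measurable_util_component[OF ij(1) g(1)] measurable_util_component[OF ij(2) g(1)]
    measurable_pair_pot[OF ij(1,2) g(3), of c \<theta> \<eta>]
  have [measurable]: "kj \<in> borel_measurable ?P" "ki \<in> borel_measurable ?P" "h \<in> borel_measurable ?P"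
    unfolding kj_def ki_def h_def by measurable
  have "(\<integral>\<^sup>+ \<xi>. ennreal (pair_pot c \<theta> \<eta> i j (g # gs) \<xi>) \<partial>?P) = (\<integral>\<^sup>+ \<xi>. kj \<xi> * (ki \<xi> * h \<xi>) \<partial>?P)"
    by (intro nn_integral_cong)
       (simp add: pair_pot_def kj_def ki_def h_def algebra_simps flip: ennreal_mult exp_add)
  also have "\<dots> \<le> ennreal (2 * \<beta> / \<theta>) * (\<integral>\<^sup>+ \<xi>. ki \<xi> * h \<xi> \<partial>?P)"
    unfolding util_space_def
  proof (rule nn_integral_PiM_peel[where c="(j,g)" and k=kj and h="\<lambda>\<xi>. ki \<xi> * h \<xi>"])
    show "(\<lambda>\<xi>. ki \<xi> * h \<xi>) \<in> borel_measurable (Pi\<^sub>M ({..<n} \<times> {..<m}) (\<lambda>_. D))"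
      unfolding util_space_def[symmetric] by measurable
    show "(\<integral>\<^sup>+ v. kj (\<xi>((j, g) := v)) \<partial>D) \<le> ennreal (2 * \<beta> / \<theta>)" for \<xi>
      unfolding kj_def upd using D_exp_abs_le[OF \<theta>] by simp
    show "ki (\<xi>((j, g) := v)) * h (\<xi>((j, g) := v)) = ki \<xi> * h \<xi>" for \<xi> v
      unfolding ki_def h_def pair_pot_def upd using ij by simp
  qed (use ij g prob_space_D in \<open>auto simp flip: util_space_def\<close>)
  also have "(\<integral>\<^sup>+ \<xi>. ki \<xi> * h \<xi> \<partial>?P) \<le> ennreal (2 * \<beta> / \<eta>) * (\<integral>\<^sup>+ \<xi>. h \<xi> \<partial>?P)"
    unfolding util_space_def
  proof (rule nn_integral_PiM_peel[where c="(i,g)" and k=ki and h=h])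
    show "(\<integral>\<^sup>+ v. ki (\<xi>((i, g) := v)) \<partial>D) \<le> ennreal (2 * \<beta> / \<eta>)" for \<xi>
      unfolding ki_def upd using D_exp_abs_le[OF \<eta>] by simp
    show "h (\<xi>((i, g) := v)) = h \<xi>" for \<xi> v
      unfolding h_def pair_pot_def upd by simp
  qed (use ij g prob_space_D in \<open>auto simp flip: util_space_def\<close>)
  also have "(\<integral>\<^sup>+ \<xi>. h \<xi> \<partial>?P) \<le> ennreal ((2 * \<beta> / \<theta>) * (2 * \<beta> / \<eta>)) ^ length gs"
    unfolding h_def using Cons by simp
  also have "ennreal (2 * \<beta> / \<theta>) * (ennreal (2 * \<beta> / \<eta>) * ennreal ((2 * \<beta> / \<theta>) * (2 * \<beta> / \<eta>)) ^ length gs)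
           = ennreal ((2 * \<beta> / \<theta>) * (2 * \<beta> / \<eta>)) ^ length (g # gs)"
    using \<beta>_pos \<theta> \<eta> by (simp add: mult.assoc ennreal_mult del: times_divide_eq_left times_divide_eq_right)
  finally show ?case by (simp add: mult_left_mono)
qed

end

section \<open>Potentials of single items\<close>

text \<open>Different items occupy disjoint blocks of coordinates, hence are independent.
  \<open>F_cong\<close> makes each \<open>F g\<close> depend on its own column only, so the same
  function can be evaluated on the full matrix and on the column.\<close>

lemma nn_integral_PiM_columns:
  fixes M :: "'a \<times> 'b \<Rightarrow> 'c measure"
  assumes M: "product_sigma_finite M" and R: "finite R" and G: "finite G"
    and F: "\<And>g. g \<in> G \<Longrightarrow> F g \<in> borel_measurable (Pi\<^sub>M (R \<times> {g}) M)"
    and F_cong: "\<And>g \<xi> \<xi>'. (\<And>a. a \<in> R \<Longrightarrow> \<xi> (a, g) = \<xi>' (a, g)) \<Longrightarrow> F g \<xi> = F g \<xi>'"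
  shows "(\<integral>\<^sup>+ \<xi>. (\<Prod>g\<in>G. F g \<xi>) \<partial>Pi\<^sub>M (R \<times> G) M) = (\<Prod>g\<in>G. \<integral>\<^sup>+ \<xi>. F g \<xi> \<partial>Pi\<^sub>M (R \<times> {g}) M)"
proof -
  interpret product_sigma_finite M by (rule M)
  show ?thesis
    using G F
  proof (induction G)
    case empty
    thus ?case by (simp add: space_PiM)
  next
    case (insert g G)
    have un: "R \<times> insert g G = R \<times> G \<union> R \<times> {g}" by auto
    have F_restr: "F h \<xi> = F h (restrict \<xi> (R \<times> {h}))" for h \<xi>
      by (rule F_cong) auto
    have meas: "F h \<in> borel_measurable (Pi\<^sub>M (R \<times> H) M)" if "h \<in> insert g G" "h \<in> H" for h H
    proof -
      have "(\<lambda>\<xi>. F h (restrict \<xi> (R \<times> {h}))) \<in> borel_measurable (Pi\<^sub>M (R \<times> H) M)"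
        by (rule measurable_compose[OF measurable_restrict_subset insert.prems]) (use that in auto)
      thus ?thesis using F_restr by simp
    qed
    have "(\<integral>\<^sup>+ \<xi>. (\<Prod>h\<in>insert g G. F h \<xi>) \<partial>Pi\<^sub>M (R \<times> insert g G) M)
        = (\<integral>\<^sup>+ \<xi>. \<integral>\<^sup>+ \<zeta>. (\<Prod>h\<in>insert g G. F h (merge (R \<times> G) (R \<times> {g}) (\<xi>, \<zeta>))) \<partial>Pi\<^sub>M (R \<times> {g}) M \<partial>Pi\<^sub>M (R \<times> G) M)"
      unfolding un
    proof (rule product_nn_integral_fold)
      show "(\<lambda>\<xi>. \<Prod>h\<in>insert g G. F h \<xi>) \<in> borel_measurable (Pi\<^sub>M (R \<times> G \<union> R \<times> {g}) M)"
        unfolding un[symmetric] by (intro borel_measurable_prod_ennreal meas) auto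
    qed (use insert R in auto)
    also have "\<dots> = (\<integral>\<^sup>+ \<xi>. \<integral>\<^sup>+ \<zeta>. F g \<zeta> * (\<Prod>h\<in>G. F h \<xi>) \<partial>Pi\<^sub>M (R \<times> {g}) M \<partial>Pi\<^sub>M (R \<times> G) M)"
    proof (intro nn_integral_cong)
      fix \<xi> \<zeta>
      have "F g (merge (R \<times> G) (R \<times> {g}) (\<xi>, \<zeta>)) = F g \<zeta>"
        by (rule F_cong) (use insert.hyps in \<open>auto simp: merge_def\<close>)
      moreover have "F h (merge (R \<times> G) (R \<times> {g}) (\<xi>, \<zeta>)) = F h \<xi>" if "h \<in> G" for h
        by (rule F_cong) (use that in \<open>auto simp: merge_def\<close>)
      ultimately show "(\<Prod>h\<in>insert g G. F h (merge (R \<times> G) (R \<times> {g}) (\<xi>, \<zeta>))) = F g \<zeta> * (\<Prod>h\<in>G. F h \<xi>)"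
        using insert.hyps by simp
    qed
    also have "\<dots> = (\<integral>\<^sup>+ \<zeta>. F g \<zeta> \<partial>Pi\<^sub>M (R \<times> {g}) M) * (\<integral>\<^sup>+ \<xi>. (\<Prod>h\<in>G. F h \<xi>) \<partial>Pi\<^sub>M (R \<times> G) M)"
      using meas by (simp add: nn_integral_multc nn_integral_cmult borel_measurable_prod_ennreal)
    finally show ?case using insert by simp
  qed
qed

text \<open>Potential of item \<open>g\<close> for the event that agent \<open>j\<close> loses all her favourites (value above \<open>1 - y\<close>)
  because of the agents \<open>B\<close>, who lost their own top items (value above \<open>1 - x\<close>). Only items of these
  two kinds count: \<open>z\<close> rewards an agent of \<open>B\<close> who wants \<open>g\<close> without having it as a top item, \<open>1/8\<close>
  penalises \<open>g\<close> if no agent outside \<open>B\<close> has it as a top item.\<close>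

definition column_pot ::
  "real \<Rightarrow> real \<Rightarrow> real \<Rightarrow> nat \<Rightarrow> nat \<Rightarrow> nat set \<Rightarrow> nat \<Rightarrow> (nat \<times> nat \<Rightarrow> real) \<Rightarrow> real" where
  "column_pot x y z n j B g \<xi> =
     (if 1 - y < \<xi> (j, g) \<or> (\<exists>b\<in>B. 1 - x < \<xi> (b, g))
      then (\<Prod>b\<in>B. if 1 - y < \<xi> (b, g) \<and> \<xi> (b, g) \<le> 1 - x then z else 1) *
           (if \<exists>a\<in>{..<n} - insert j B. 1 - x < \<xi> (a, g) then 1 else 1/8)
      else 1)"

text \<open>The rewards are regrouped by agent instead of by item. Every agent of \<open>B\<close>
  then has at least one factor \<open>z\<close> while all her other factors are at least 1, and at
  most \<open>r\<close> items incur the penalty \<open>1/8\<close>.\<close>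

lemma prod_column_pot_ge:
  assumes z: "z \<ge> 1" and "finite B"
    and U: "\<And>g. g < m \<Longrightarrow> g \<in> U \<longleftrightarrow> 1 - y < \<xi> (j, g) \<or> (\<exists>b\<in>B. 1 - x < \<xi> (b, g))"
    and hit: "\<And>b. b \<in> B \<Longrightarrow> \<exists>g<m. g \<in> U \<and> 1 - y < \<xi> (b, g) \<and> \<xi> (b, g) \<le> 1 - x"
    and few: "card {g. g < m \<and> g \<in> U \<and> (\<forall>a\<in>{..<n} - insert j B. \<xi> (a, g) \<le> 1 - x)} \<le> r"
  shows "z ^ card B * (1/8) ^ r \<le> (\<Prod>g<m. column_pot x y z n j B g \<xi>)"
proof -
  define V where "V = {g. g < m \<and> g \<in> U \<and> (\<forall>a\<in>{..<n} - insert j B. \<xi> (a, g) \<le> 1 - x)}"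
  define c where "c = (\<lambda>b g. if g \<in> U \<and> 1 - y < \<xi> (b, g) \<and> \<xi> (b, g) \<le> 1 - x then z else 1)"
  have c1: "c b g \<ge> 1" for b g using z by (simp add: c_def)
  have "column_pot x y z n j B g \<xi> = (\<Prod>b\<in>B. c b g) * (if g \<in> V then 1/8 else 1)" if "g < m" for g
  proof (cases "g \<in> U")
    case True
    hence "(\<exists>a\<in>{..<n} - insert j B. 1 - x < \<xi> (a, g)) \<longleftrightarrow> g \<notin> V"
      using that by (auto simp: V_def not_le)
    thus ?thesis using U[OF that] True by (simp only: column_pot_def c_def if_True simp_thms if_not_P) simp
  next
    case False
    thus ?thesis using U[OF that] by (simp only: column_pot_def c_def V_def) simp
  qed
  hence "(\<Prod>g<m. column_pot x y z n j B g \<xi>) = (\<Prod>g<m. \<Prod>b\<in>B. c b g) * (\<Prod>g<m. if g \<in> V then 1/8 else 1)"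
    by (simp add: prod.distrib)
  also have "(\<Prod>g<m. \<Prod>b\<in>B. c b g) = (\<Prod>b\<in>B. \<Prod>g<m. c b g)"
    by (rule prod.swap)
  also have "(\<Prod>g<m. if g \<in> V then 1/8 else 1) = (1/8::real) ^ card V"
  proof -
    have "{..<m} \<inter> V = V" by (auto simp: V_def)
    thus ?thesis by (simp add: prod.If_cases)
  qed
  finally have eq: "(\<Prod>g<m. column_pot x y z n j B g \<xi>) = (\<Prod>b\<in>B. \<Prod>g<m. c b g) * (1/8) ^ card V" .
  have "z ^ card B = (\<Prod>b\<in>B. z)" by simp
  also have "\<dots> \<le> (\<Prod>b\<in>B. \<Prod>g<m. c b g)"
  proof (rule prod_mono, safe)
    fix b assume "b \<in> B"
    then obtain g where g: "g < m" "c b g = z" using hit[of b] by (auto simp: c_def)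
    have "z = c b g * 1" using g by simp
    also have "\<dots> \<le> c b g * (\<Prod>g\<in>{..<m} - {g}. c b g)"
      using c1 order.trans[OF zero_le_one c1] by (intro mult_left_mono prod_ge_1) auto
    also have "\<dots> = (\<Prod>g<m. c b g)"
      using g by (simp add: prod.remove)
    finally show "z \<le> (\<Prod>g<m. c b g)" .
  qed (use z in auto)
  finally have "z ^ card B \<le> (\<Prod>b\<in>B. \<Prod>g<m. c b g)" .
  moreover have "(1/8::real) ^ r \<le> (1/8) ^ card V"
    using few by (intro power_decreasing) (auto simp: V_def)
  ultimately show ?thesis
    unfolding eq using z by (intro mult_mono) (auto intro!: prod_nonneg order.trans[OF zero_le_one c1])
qed

lemma ennreal_union_bound_sum:
  assumes "0 \<le> A" "0 \<le> c" "\<And>b. b \<in> S \<Longrightarrow> 0 \<le> t b" "\<And>b e. b \<in> S \<Longrightarrow> e \<in> N \<Longrightarrow> 0 \<le> u b e"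
  shows "ennreal (A + (\<Sum>b\<in>S. c * t b + (\<Sum>e\<in>N. u b e)))
       = ennreal A + (\<Sum>b\<in>S. ennreal c * ennreal (t b) + (\<Sum>e\<in>N. ennreal (u b e)))"
proof -
  have "ennreal (c * t b + (\<Sum>e\<in>N. u b e)) = ennreal c * ennreal (t b) + (\<Sum>e\<in>N. ennreal (u b e))"
    if "b \<in> S" for b
    using assms that by (simp add: ennreal_plus ennreal_mult sum_nonneg)
  moreover have "ennreal (A + (\<Sum>b\<in>S. c * t b + (\<Sum>e\<in>N. u b e)))
      = ennreal A + (\<Sum>b\<in>S. ennreal (c * t b + (\<Sum>e\<in>N. u b e)))"
    using assms by (subst ennreal_plus) (auto intro!: sum_nonneg add_nonneg_nonneg sum_ennreal[symmetric])
  ultimately show ?thesis by simp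
qed

lemma nn_integral_union_bound_sum:
  fixes f0 :: "'a \<Rightarrow> ennreal"
  assumes [measurable]: "f0 \<in> borel_measurable M" "\<And>b. t b \<in> borel_measurable M"
    "\<And>b e. u b e \<in> borel_measurable M"
  shows "(\<integral>\<^sup>+ \<xi>. f0 \<xi> + (\<Sum>b\<in>S. c * t b \<xi> + (\<Sum>e\<in>N. u b e \<xi>)) \<partial>M)
       = (\<integral>\<^sup>+ \<xi>. f0 \<xi> \<partial>M) + (\<Sum>b\<in>S. c * (\<integral>\<^sup>+ \<xi>. t b \<xi> \<partial>M) + (\<Sum>e\<in>N. \<integral>\<^sup>+ \<xi>. u b e \<xi> \<partial>M))"
  by (simp add: nn_integral_add nn_integral_sum nn_integral_cmult)

section \<open>Expected potential of a single item and of all items\<close>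

context bounded_density
begin

lemma nn_integral_column_prod_le:
  fixes n g :: nat and \<phi> :: "nat \<Rightarrow> real \<Rightarrow> real" and c :: "nat \<Rightarrow> real"
  assumes "\<And>a. a < n \<Longrightarrow> \<phi> a \<in> borel_measurable borel"
    and "\<And>a v. a < n \<Longrightarrow> 0 \<le> \<phi> a v"
    and "\<And>a. a < n \<Longrightarrow> (\<integral>\<^sup>+ v. ennreal (\<phi> a v) \<partial>D) \<le> ennreal (c a)"
    and "\<And>a. a < n \<Longrightarrow> 0 \<le> c a"
  shows "(\<integral>\<^sup>+ \<xi>. ennreal (\<Prod>a<n. \<phi> a (\<xi> (a, g))) \<partial>Pi\<^sub>M ({..<n} \<times> {g}) (\<lambda>_. D)) \<le> ennreal (\<Prod>a<n. c a)"
proof -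
  have cells: "(\<Prod>k\<in>{..<n} \<times> {g}. H (fst k) k) = (\<Prod>a<n. H a (a, g))" for H :: "nat \<Rightarrow> nat \<times> nat \<Rightarrow> ennreal"
    by (rule prod.reindex_bij_witness[where i="\<lambda>a. (a, g)" and j=fst]) auto
  have "(\<integral>\<^sup>+ \<xi>. ennreal (\<Prod>a<n. \<phi> a (\<xi> (a, g))) \<partial>Pi\<^sub>M ({..<n} \<times> {g}) (\<lambda>_. D))
      = (\<integral>\<^sup>+ \<xi>. (\<Prod>k\<in>{..<n} \<times> {g}. ennreal (\<phi> (fst k) (\<xi> k))) \<partial>Pi\<^sub>M ({..<n} \<times> {g}) (\<lambda>_. D))"
  proof (intro nn_integral_cong)
    fix \<xi> :: "nat \<times> nat \<Rightarrow> real"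
    have "ennreal (\<Prod>a<n. \<phi> a (\<xi> (a, g))) = (\<Prod>a<n. ennreal (\<phi> a (\<xi> (a, g))))"
      using assms(2) by (intro prod_ennreal[symmetric]) auto
    also have "\<dots> = (\<Prod>k\<in>{..<n} \<times> {g}. ennreal (\<phi> (fst k) (\<xi> k)))"
      using cells[of "\<lambda>a k. ennreal (\<phi> a (\<xi> k))"] by simp
    finally show "ennreal (\<Prod>a<n. \<phi> a (\<xi> (a, g))) = \<dots>" .
  qed
  also have "\<dots> = (\<Prod>k\<in>{..<n} \<times> {g}. \<integral>\<^sup>+ v. ennreal (\<phi> (fst k) v) \<partial>D)"
    using assms(1) by (intro product_sigma_finite.product_nn_integral_prod[OF product_sigma_finite_D]) auto
  also have "\<dots> = (\<Prod>a<n. \<integral>\<^sup>+ v. ennreal (\<phi> a v) \<partial>D)"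
    by (rule cells)
  also have "\<dots> \<le> (\<Prod>a<n. ennreal (c a))"
    using assms(3) by (intro prod_mono_ennreal) auto
  also have "\<dots> = ennreal (\<Prod>a<n. c a)"
    using assms(4) by (intro prod_ennreal) auto
  finally show ?thesis .
qed

lemma nn_integral_D_of_bool: "{v. P v} \<in> sets borel \<Longrightarrow> (\<integral>\<^sup>+ v. ennreal (of_bool (P v)) \<partial>D) = ennreal (D.prob {v. P v})"
proof -
  assume *: "{v. P v} \<in> sets borel"
  have "(\<integral>\<^sup>+ v. ennreal (of_bool (P v)) \<partial>D) = (\<integral>\<^sup>+ v. indicator {v. P v} v \<partial>D)"
    by (intro nn_integral_cong) (auto simp: indicator_def)
  also have "\<dots> = ennreal (D.prob {v. P v})" using * by (simp add: D.emeasure_eq_measure)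
  finally show ?thesis .
qed

text \<open>A union bound over the ways in which the item can count. With
  \<open>s = q + card B * p\<close>, it does not count with probability at most
  \<open>exp (- s)\<close>. Otherwise some \<open>b\<close> in \<open>insert j B\<close> likes it
  enough, which costs \<open>s\<close> in total; then either the weight \<open>1/8\<close> is paid
  or some outsider has it as a top item, which costs at most \<open>n * p \<le> 1/8\<close>.
  Replacing \<open>1 - s\<close> by roughly \<open>1 - s + s/4\<close> leaves a definite loss per
  item.\<close>

lemma nn_integral_column_pot:
  fixes x y z p q :: real
  defines "p \<equiv> D.prob {1-x<..}" and "q \<equiv> D.prob {1-y<..}"
  assumes j: "j < n" and B: "B \<subseteq> {..<n} - {j}" and z: "z \<ge> 1"
    and np: "real n * p \<le> 1/8" and q: "q \<le> 1/4" and kqz: "real (card B) * q * (z - 1) \<le> 1/5"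
  shows "(\<integral>\<^sup>+ \<xi>. ennreal (column_pot x y z n j B g \<xi>) \<partial>Pi\<^sub>M ({..<n} \<times> {g}) (\<lambda>_. D))
       \<le> ennreal (exp (- (q + card B * p) / 4))"
proof -
  let ?C = "Pi\<^sub>M ({..<n} \<times> {g}) (\<lambda>_. D)"
  define k where "k = card B"
  define N where "N = {..<n} - insert j B"
  define \<zeta> where "\<zeta> = 1 + q * (z - 1)"
  have [simp]: "p \<ge> 0" "q \<ge> 0" by (auto simp: p_def q_def)
  have finB [simp]: "finite B" using B finite_subset by blast
  have jB: "j \<notin> B" "\<And>b. b \<in> B \<Longrightarrow> b < n" using B by auto
  have kn: "k \<le> n" unfolding k_def using card_mono[of "{..<n}" B] B by auto
  have \<zeta>1: "\<zeta> \<ge> 1" using z by (simp add: \<zeta>_def)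
  define none :: "nat \<Rightarrow> real \<Rightarrow> real" where
    "none = (\<lambda>a v. if a = j then of_bool (v \<le> 1 - y) else if a \<in> B then of_bool (v \<le> 1 - x) else 1)"
  define hit :: "nat \<Rightarrow> nat option \<Rightarrow> nat \<Rightarrow> real \<Rightarrow> real" where
    \<comment> \<open>Here \<open>b\<close> is the agent who makes the item count, and
      \<open>e\<close> is an outsider required to have it as a top item, with \<open>None\<close>
      for no such requirement. An agent \<open>b\<close> of \<open>B\<close> gets no
      \<open>z\<close>: her value exceeds \<open>1 - x\<close>, where the reward does not apply.
      This makes \<open>T b e\<close> a product over agents.\<close>
    "hit = (\<lambda>b e a v. if a = b then of_bool (1 - (if b = j then y else x) < v)
       else if a \<in> B then (if 1 - y < v \<and> v \<le> 1 - x then z else 1)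
       else if e = Some a then of_bool (1 - x < v) else 1)"
  define T where "T = (\<lambda>b e (\<xi> :: nat \<times> nat \<Rightarrow> real). \<Prod>a<n. hit b e a (\<xi> (a, g)))"
  have hit_nonneg: "0 \<le> hit b e a v" for b e a v using z by (simp add: hit_def)
  have T_nonneg: "0 \<le> T b e \<xi>" for b e \<xi> unfolding T_def by (intro prod_nonneg) (simp add: hit_nonneg)
  have none_nonneg: "0 \<le> none a v" for a v by (simp add: none_def)

  have pointwise: "column_pot x y z n j B g \<xi> \<le>
      (\<Prod>a<n. none a (\<xi> (a, g))) + (\<Sum>b\<in>insert j B. 1/8 * T b None \<xi> + (\<Sum>e\<in>N. T b (Some e) \<xi>))" for \<xi>
  proof (cases "1 - y < \<xi> (j, g) \<or> (\<exists>b\<in>B. 1 - x < \<xi> (b, g))")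
    case False
    hence "none a (\<xi> (a, g)) = 1" for a by (auto simp: none_def)
    moreover have "column_pot x y z n j B g \<xi> = 1" using False by (auto simp: column_pot_def)
    moreover have "0 \<le> (\<Sum>b\<in>insert j B. 1/8 * T b None \<xi> + (\<Sum>e\<in>N. T b (Some e) \<xi>))"
      by (intro sum_nonneg add_nonneg_nonneg mult_nonneg_nonneg) (auto simp: T_nonneg)
    ultimately show ?thesis by simp
  next
    case True
    define Z where "Z = (\<Prod>b\<in>B. if 1 - y < \<xi> (b, g) \<and> \<xi> (b, g) \<le> 1 - x then z else 1)"
    from True obtain b where b: "b \<in> insert j B" "1 - (if b = j then y else x) < \<xi> (b, g)"
      using jB by (metis insertCI)
    have TZ: "T b e \<xi> = Z" if "\<And>a. e = Some a \<Longrightarrow> 1 - x < \<xi> (a, g)" for e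
    proof -
      have "hit b e a (\<xi> (a, g)) = (if a \<in> B then if 1 - y < \<xi> (a, g) \<and> \<xi> (a, g) \<le> 1 - x then z else 1 else 1)" for a
        using b that jB by (auto simp: hit_def split: if_splits)
      moreover have "{..<n} \<inter> B = B" using B by auto
      ultimately show ?thesis unfolding T_def Z_def
        by (simp add: prod.If_cases Int_absorb1 flip: prod.inter_restrict)
    qed
    have nonneg: "0 \<le> 1/8 * T b None \<xi> + (\<Sum>e\<in>N. T b (Some e) \<xi>)" for b
      by (intro sum_nonneg add_nonneg_nonneg mult_nonneg_nonneg) (auto simp: T_nonneg)
    have "column_pot x y z n j B g \<xi> = Z * (if \<exists>a\<in>N. 1 - x < \<xi> (a, g) then 1 else 1/8)"
      unfolding column_pot_def Z_def N_def by (simp only: True if_True)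
    also have "\<dots> \<le> 1/8 * T b None \<xi> + (\<Sum>e\<in>N. T b (Some e) \<xi>)"
    proof (cases "\<exists>a\<in>N. 1 - x < \<xi> (a, g)")
      case True
      then obtain e where "e \<in> N" "1 - x < \<xi> (e, g)" by auto
      hence "Z = T b (Some e) \<xi>" using TZ[of "Some e"] by simp
      also have "\<dots> \<le> (\<Sum>e\<in>N. T b (Some e) \<xi>)"
        using \<open>e \<in> N\<close> by (intro member_le_sum) (auto simp: T_nonneg N_def)
      also have "\<dots> \<le> 1/8 * T b None \<xi> + (\<Sum>e\<in>N. T b (Some e) \<xi>)" using T_nonneg by simp
      finally show ?thesis using True by simp
    next
      case False
      have "Z = T b None \<xi>" using TZ[of None] by simp
      thus ?thesis using False T_nonneg by (simp add: sum_nonneg)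
    qed
    also have "\<dots> \<le> (\<Sum>b\<in>insert j B. 1/8 * T b None \<xi> + (\<Sum>e\<in>N. T b (Some e) \<xi>))"
      by (rule member_le_sum[OF b(1)]) (use nonneg in auto)
    also have "\<dots> \<le> (\<Prod>a<n. none a (\<xi> (a, g))) + (\<Sum>b\<in>insert j B. 1/8 * T b None \<xi> + (\<Sum>e\<in>N. T b (Some e) \<xi>))"
      using none_nonneg by (simp add: prod_nonneg)
    finally show ?thesis .
  qed

  have gt: "{v. 1 - c < v} = {1 - c<..}" for c :: real by auto
  have le: "D.prob {v. v \<le> 1 - c} = 1 - D.prob {1 - c<..}" for c
  proof -
    have "{v. v \<le> 1 - c} = space D - {1 - c<..}" by auto
    thus ?thesis by (simp add: D.prob_compl del: space_D)
  qed
  have cell: "(\<lambda>\<xi>. h (\<xi> (a, g))) \<in> borel_measurable ?C" if "a < n" "h \<in> borel_measurable borel" for a and h :: "real \<Rightarrow> real"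
    using measurable_compose[OF measurable_component_singleton[of "(a, g)" "{..<n} \<times> {g}" "\<lambda>_. D"]] that
    by simp
  have none_meas: "none a \<in> borel_measurable borel" for a unfolding none_def by measurable
  have hit_meas: "hit b e a \<in> borel_measurable borel" for b e a unfolding hit_def by measurable
  have T_meas: "T b e \<in> borel_measurable ?C" for b e
    unfolding T_def by (intro borel_measurable_prod cell hit_meas) auto

  have none_int: "(\<integral>\<^sup>+ \<xi>. ennreal (\<Prod>a<n. none a (\<xi> (a, g))) \<partial>?C) \<le> ennreal (exp (- (q + k * p)))"
  proof -
    define c where "c = (\<lambda>a. if a = j then exp (- q) else if a \<in> B then exp (- p) else 1)"
    have "(\<integral>\<^sup>+ \<xi>. ennreal (\<Prod>a<n. none a (\<xi> (a, g))) \<partial>?C) \<le> ennreal (\<Prod>a<n. c a)"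
    proof (rule nn_integral_column_prod_le)
      fix a assume "a < n"
      have "1 - p \<le> exp (- p)" "1 - q \<le> exp (- q)"
        using exp_ge_add_one_self[of "-p"] exp_ge_add_one_self[of "-q"] by auto
      thus "(\<integral>\<^sup>+ v. ennreal (none a v) \<partial>D) \<le> ennreal (c a)"
        by (auto simp: none_def c_def nn_integral_D_of_bool le p_def q_def D.emeasure_space_1[simplified] intro!: ennreal_leI)
    qed (auto simp: none_meas none_nonneg c_def)
    also have "(\<Prod>a<n. c a) = (\<Prod>a<n. (if a = j then exp (- q) else 1) * (if a \<in> B then exp (- p) else 1))"
      by (intro prod.cong) (use jB in \<open>auto simp: c_def\<close>)
    also have "\<dots> = exp (- q) * exp (- p) ^ k"
      using j B by (simp add: prod.distrib prod.delta k_def prod.If_cases Int_absorb1 subset_iff)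
    also have "\<dots> = exp (- (q + k * p))"
      by (simp flip: exp_of_nat_mult exp_add)
    finally show ?thesis .
  qed

  have T_int: "(\<integral>\<^sup>+ \<xi>. ennreal (T b e \<xi>) \<partial>?C)
      \<le> ennreal ((if b = j then q else p) * \<zeta> ^ k * (if e = None then 1 else p))"
    if b: "b \<in> insert j B" and e: "\<And>a. e = Some a \<Longrightarrow> a \<in> N" for b e
  proof -
    define r where "r = (if b = j then q else p)"
    define c where "c = (\<lambda>a. if a = b then r else if a \<in> B then \<zeta> else if e = Some a then p else 1)"
    have r0: "r \<ge> 0" by (simp add: r_def)
    have "(\<integral>\<^sup>+ \<xi>. ennreal (T b e \<xi>) \<partial>?C) \<le> ennreal (\<Prod>a<n. c a)"
      unfolding T_def
    proof (rule nn_integral_column_prod_le)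
      fix a assume "a < n"
      \<comment> \<open>Dropping the upper cutoff \<open>1 - x\<close> only enlarges the integrand,
        so the extra \<open>z - 1\<close> is charged to the whole tail of probability
        \<open>q\<close>.\<close>
      have \<zeta>_int: "(\<integral>\<^sup>+ v. ennreal (if 1 - y < v \<and> v \<le> 1 - x then z else 1) \<partial>D) \<le> ennreal \<zeta>"
      proof -
        have split_z: "1 + ennreal (z - 1) = ennreal z"
          using ennreal_plus[of 1 "z - 1"] z by simp
        have "(\<integral>\<^sup>+ v. ennreal (if 1 - y < v \<and> v \<le> 1 - x then z else 1) \<partial>D)
            \<le> (\<integral>\<^sup>+ v. 1 + ennreal (z - 1) * indicator {1-y<..} v \<partial>D)"
          by (intro nn_integral_mono) (auto simp: indicator_def split_z z)
        also have "\<dots> = (\<integral>\<^sup>+ v. 1 \<partial>D) + ennreal (z - 1) * emeasure D {1-y<..}"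
          by (subst nn_integral_add) (simp_all add: nn_integral_cmult_indicator)
        also have "\<dots> = ennreal 1 + ennreal (z - 1) * ennreal q"
          using D.emeasure_space_1 by (simp add: D.emeasure_eq_measure q_def)
        also have "\<dots> = ennreal \<zeta>"
          using z by (simp only: ennreal_mult'[symmetric] ennreal_plus[symmetric] \<open>0 \<le> q\<close> mult_nonneg_nonneg
              diff_ge_0_iff_ge zero_le_one \<zeta>_def mult.commute)
        finally show ?thesis .
      qed
      show "(\<integral>\<^sup>+ v. ennreal (hit b e a v) \<partial>D) \<le> ennreal (c a)"
        using \<zeta>_int
        by (auto simp: hit_def c_def r_def nn_integral_D_of_bool gt p_def q_def D.emeasure_space_1[simplified])
    qed (use \<zeta>1 in \<open>auto simp: hit_meas hit_nonneg c_def r0\<close>)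
    also have "(\<Prod>a<n. c a) = (\<Prod>a<n. (if a = b then r else 1) * (if a \<in> B - {b} then \<zeta> else 1) * (if e = Some a then p else 1))"
    proof (intro prod.cong refl)
      fix a
      have "e \<noteq> Some a" if "a = b \<or> a \<in> B" using that b e[of a] by (auto simp: N_def)
      thus "c a = (if a = b then r else 1) * (if a \<in> B - {b} then \<zeta> else 1) * (if e = Some a then p else 1)"
        by (auto simp: c_def)
    qed
    also have "\<dots> = r * \<zeta> ^ card (B - {b}) * (\<Prod>a<n. if e = Some a then p else 1)"
    proof -
      have "b < n" using b j jB by auto
      moreover have "{..<n} \<inter> (B - {b}) = B - {b}" using B by auto
      ultimately show ?thesis by (simp add: prod.distrib prod.delta prod.If_cases del: Diff_iff)
    qed
    also have "(\<Prod>a<n. if e = Some a then p else 1) = (if e = None then 1 else p)"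
      using e by (cases e) (auto simp: N_def prod.delta')
    also have "r * \<zeta> ^ card (B - {b}) * (if e = None then 1 else p) \<le> r * \<zeta> ^ k * (if e = None then 1 else p)"
      unfolding k_def using r0 \<zeta>1 by (intro mult_mono power_increasing card_mono) auto
    finally show ?thesis unfolding r_def by (auto simp: ennreal_leI)
  qed

  define s where "s = q + k * p"
  have s0: "s \<ge> 0" by (simp add: s_def)
  have kp: "k * p \<le> 1/8"
    using np kn mult_right_mono[of "real k" "real n" p] by simp
  have Np: "real (card N) * p \<le> 1/8"
  proof -
    have "card N \<le> n" unfolding N_def using card_mono[of "{..<n}" "{..<n} - insert j B"] by auto
    thus ?thesis using np mult_right_mono[of "real (card N)" "real n" p] by simp
  qed
  \<comment> \<open>The rewards of all agents in \<open>B\<close> together inflate the bound by at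
    most \<open>exp (1/5)\<close>, and \<open>1 + 1/5 + 1/25\<close> is below
    \<open>5/4\<close>.\<close>
  have \<zeta>k: "\<zeta> ^ k \<le> 5/4"
  proof -
    have "\<zeta> \<le> exp (q * (z - 1))" unfolding \<zeta>_def by (rule exp_ge_add_one_self)
    hence "\<zeta> ^ k \<le> exp (q * (z - 1)) ^ k" using \<zeta>1 by (intro power_mono) auto
    also have "\<dots> = exp (real (card B) * q * (z - 1))" by (simp add: k_def exp_of_nat_mult mult.assoc)
    also have "\<dots> \<le> exp (1/5)" using kqz by simp
    also have "\<dots> \<le> 1 + 1/5 + (1/5)\<^sup>2" by (rule exp_bound) auto
    also have "\<dots> \<le> 5/4" by (simp add: power2_eq_square)
    finally show ?thesis .
  qed

  have "(\<integral>\<^sup>+ \<xi>. ennreal (column_pot x y z n j B g \<xi>) \<partial>?C)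
     \<le> (\<integral>\<^sup>+ \<xi>. ennreal (\<Prod>a<n. none a (\<xi> (a, g))) +
          (\<Sum>b\<in>insert j B. ennreal (1/8) * ennreal (T b None \<xi>) + (\<Sum>e\<in>N. ennreal (T b (Some e) \<xi>))) \<partial>?C)"
  proof (intro nn_integral_mono)
    fix \<xi>
    have "ennreal (column_pot x y z n j B g \<xi>) \<le> ennreal
      ((\<Prod>a<n. none a (\<xi> (a, g))) + (\<Sum>b\<in>insert j B. 1/8 * T b None \<xi> + (\<Sum>e\<in>N. T b (Some e) \<xi>)))"
      by (intro ennreal_leI pointwise)
    also have "\<dots> = ennreal (\<Prod>a<n. none a (\<xi> (a, g))) +
          (\<Sum>b\<in>insert j B. ennreal (1/8) * ennreal (T b None \<xi>) + (\<Sum>e\<in>N. ennreal (T b (Some e) \<xi>)))"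
      by (intro ennreal_union_bound_sum) (auto simp: T_nonneg none_nonneg prod_nonneg)
    finally show "ennreal (column_pot x y z n j B g \<xi>) \<le> ennreal (\<Prod>a<n. none a (\<xi> (a, g))) +
          (\<Sum>b\<in>insert j B. ennreal (1/8) * ennreal (T b None \<xi>) + (\<Sum>e\<in>N. ennreal (T b (Some e) \<xi>)))" .
  qed
  also have "\<dots> = (\<integral>\<^sup>+ \<xi>. ennreal (\<Prod>a<n. none a (\<xi> (a, g))) \<partial>?C) +
       (\<Sum>b\<in>insert j B. ennreal (1/8) * (\<integral>\<^sup>+ \<xi>. ennreal (T b None \<xi>) \<partial>?C)
            + (\<Sum>e\<in>N. \<integral>\<^sup>+ \<xi>. ennreal (T b (Some e) \<xi>) \<partial>?C))"
  proof -
    have [measurable]: "(\<lambda>\<xi>. \<Prod>a<n. none a (\<xi> (a, g))) \<in> borel_measurable ?C"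
      by (intro borel_measurable_prod cell none_meas) auto
    show ?thesis
      by (intro nn_integral_union_bound_sum measurable_compose[OF _ measurable_ennreal] T_meas) measurable
  qed
  also have "\<dots> \<le> ennreal (exp (- s)) +
      (\<Sum>b\<in>insert j B. ennreal (1/8) * ennreal ((if b = j then q else p) * \<zeta> ^ k)
            + (\<Sum>e\<in>N. ennreal ((if b = j then q else p) * \<zeta> ^ k * p)))"
  proof (intro add_mono sum_mono mult_left_mono)
    fix b assume b: "b \<in> insert j B"
    show "(\<integral>\<^sup>+ \<xi>. ennreal (T b None \<xi>) \<partial>?C) \<le> ennreal ((if b = j then q else p) * \<zeta> ^ k)"
      using T_int[OF b, of None] by simp
    fix e assume "e \<in> N"
    thus "(\<integral>\<^sup>+ \<xi>. ennreal (T b (Some e) \<xi>) \<partial>?C) \<le> ennreal ((if b = j then q else p) * \<zeta> ^ k * p)"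
      using T_int[OF b, of "Some e"] by simp
  qed (use none_int in \<open>auto simp: s_def\<close>)
  also have "\<dots> = ennreal (exp (- s) + (\<Sum>b\<in>insert j B. 1/8 * ((if b = j then q else p) * \<zeta> ^ k)
            + (\<Sum>e\<in>N. (if b = j then q else p) * \<zeta> ^ k * p)))"
    using \<zeta>1 by (subst ennreal_union_bound_sum) auto
  also have "\<dots> \<le> ennreal (exp (- s / 4))"
  proof (rule ennreal_leI)
    have "(\<Sum>b\<in>insert j B. 1/8 * ((if b = j then q else p) * \<zeta> ^ k)
            + (\<Sum>e\<in>N. (if b = j then q else p) * \<zeta> ^ k * p))
        = (\<Sum>b\<in>insert j B. (if b = j then q else p) * (\<zeta> ^ k * (1/8 + card N * p)))"
      by (intro sum.cong refl) (simp add: algebra_simps)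
    also have "\<dots> = (\<Sum>b\<in>insert j B. (if b = j then q else p)) * (\<zeta> ^ k * (1/8 + card N * p))"
      by (simp add: sum_distrib_right del: sum.insert)
    also have "(\<Sum>b\<in>insert j B. (if b = j then q else p)) = s"
    proof -
      have "(\<Sum>b\<in>B. (if b = j then q else p)) = (\<Sum>b\<in>B. p)" using jB by (intro sum.cong) auto
      thus ?thesis using jB by (simp add: s_def k_def)
    qed
    also have "s * (\<zeta> ^ k * (1/8 + card N * p)) \<le> s * (5/4 * (1/4))"
      using s0 \<zeta>k Np \<zeta>1 by (intro mult_left_mono mult_mono) auto
    finally have 1: "(\<Sum>b\<in>insert j B. 1/8 * ((if b = j then q else p) * \<zeta> ^ k)
            + (\<Sum>e\<in>N. (if b = j then q else p) * \<zeta> ^ k * p)) \<le> s * (5/16)" by simp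
    have s_half: "s \<le> 1/2" using kp q by (simp add: s_def)
    have "1 + s \<le> exp s" by (rule exp_ge_add_one_self)
    hence "exp (- s) \<le> 1 / (1 + s)" using s0 by (simp add: exp_minus field_simps)
    \<comment> \<open>This needs \<open>s \<le> 1/2\<close>. The slope \<open>2/3\<close> exceeds
      \<open>5/16 + 1/4\<close>, where \<open>5/16 = 5/4 * (1/8 + 1/8)\<close> bounds the remaining
      terms, so the sum stays below \<open>1 - s / 4\<close>.\<close>
    also have "\<dots> \<le> 1 - s * (2/3)"
    proof -
      have "0 \<le> s * (1 - 2 * s)" using s0 s_half by (intro mult_nonneg_nonneg) auto
      hence "1 \<le> (1 - s * (2/3)) * (1 + s)" by (simp add: algebra_simps)
      thus ?thesis using s0 by (subst pos_divide_le_eq) auto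
    qed
    finally have 2: "exp (- s) \<le> 1 - s * (2/3)" .
    have "1 - s / 4 \<le> exp (- s / 4)" using exp_ge_add_one_self[of "- s / 4"] by simp
    thus "exp (- s) + (\<Sum>b\<in>insert j B. 1/8 * ((if b = j then q else p) * \<zeta> ^ k)
            + (\<Sum>e\<in>N. (if b = j then q else p) * \<zeta> ^ k * p)) \<le> exp (- s / 4)"
      using 1 2 s0 by linarith
  qed
  finally show ?thesis by (simp add: s_def k_def)
qed

lemma measurable_column_pot:
  assumes "j < n" "B \<subseteq> {..<n}" "g \<in> G"
  shows "column_pot x y z n j B g \<in> borel_measurable (Pi\<^sub>M ({..<n} \<times> G) (\<lambda>_. D))"
proof -
  let ?P = "Pi\<^sub>M ({..<n} \<times> G) (\<lambda>_. D)"
  have cell: "(\<lambda>\<xi>. \<xi> (a, g)) \<in> borel_measurable ?P" if "a < n" for a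
    using measurable_component_singleton[of "(a, g)" "{..<n} \<times> G" "\<lambda>_. D"] that assms by simp
  have [measurable]: "Measurable.pred ?P (\<lambda>\<xi>. c < \<xi> (a, g))" "Measurable.pred ?P (\<lambda>\<xi>. \<xi> (a, g) \<le> c)" if "a < n" for a c
    using cell[OF that] by measurable
  have ex: "Measurable.pred ?P (\<lambda>\<xi>. \<exists>a\<in>A. c < \<xi> (a, g))" if "A \<subseteq> {..<n}" for A c
    using that finite_subset[OF that] by (intro pred_intros_finite) auto
  have [measurable]: "Measurable.pred ?P (\<lambda>\<xi>. 1 - y < \<xi> (j, g) \<or> (\<exists>b\<in>B. 1 - x < \<xi> (b, g)))"
    by (rule pred_intros_logic) (use assms ex in auto)
  have [measurable]: "Measurable.pred ?P (\<lambda>\<xi>. \<exists>a\<in>{..<n} - insert j B. 1 - x < \<xi> (a, g))"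
    by (rule ex) auto
  have [measurable]: "(\<lambda>\<xi>. \<Prod>b\<in>B. if 1 - y < \<xi> (b, g) \<and> \<xi> (b, g) \<le> 1 - x then z else 1) \<in> borel_measurable ?P"
  proof (rule borel_measurable_prod)
    fix b assume "b \<in> B"
    hence "b < n" using assms by auto
    thus "(\<lambda>\<xi>. if 1 - y < \<xi> (b, g) \<and> \<xi> (b, g) \<le> 1 - x then z else 1) \<in> borel_measurable ?P"
      by measurable
  qed
  show ?thesis unfolding column_pot_def by measurable
qed

lemma nn_integral_prod_column_pot:
  fixes x y z p q :: real
  defines "p \<equiv> D.prob {1-x<..}" and "q \<equiv> D.prob {1-y<..}"
  assumes "j < n" "B \<subseteq> {..<n} - {j}" "z \<ge> 1"
    and "real n * p \<le> 1/8" "q \<le> 1/4" "real (card B) * q * (z - 1) \<le> 1/5"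
  shows "(\<integral>\<^sup>+ \<xi>. ennreal (\<Prod>g<m. column_pot x y z n j B g \<xi>) \<partial>util_space f n m)
       \<le> ennreal (exp (- (real m * (q + card B * p)) / 4))"
proof -
  have nonneg: "0 \<le> column_pot x y z n j B g \<xi>" for g \<xi>
    using assms by (auto simp: column_pot_def intro!: mult_nonneg_nonneg prod_nonneg)
  have "(\<integral>\<^sup>+ \<xi>. ennreal (\<Prod>g<m. column_pot x y z n j B g \<xi>) \<partial>util_space f n m)
      = (\<integral>\<^sup>+ \<xi>. (\<Prod>g<m. ennreal (column_pot x y z n j B g \<xi>)) \<partial>Pi\<^sub>M ({..<n} \<times> {..<m}) (\<lambda>_. D))"
    by (simp add: util_space_def prod_ennreal nonneg)
  also have "\<dots> = (\<Prod>g<m. \<integral>\<^sup>+ \<xi>. ennreal (column_pot x y z n j B g \<xi>) \<partial>Pi\<^sub>M ({..<n} \<times> {g}) (\<lambda>_. D))"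
  proof (rule nn_integral_PiM_columns[OF product_sigma_finite_D])
    fix g :: nat and \<xi> \<xi>' :: "nat \<times> nat \<Rightarrow> real"
    assume *: "\<And>a. a \<in> {..<n} \<Longrightarrow> \<xi> (a, g) = \<xi>' (a, g)"
    have "\<xi> (a, g) = \<xi>' (a, g)" if "a \<in> insert j B" for a using * that assms by auto
    moreover have "(\<exists>a\<in>{..<n} - insert j B. 1 - x < \<xi> (a, g)) \<longleftrightarrow> (\<exists>a\<in>{..<n} - insert j B. 1 - x < \<xi>' (a, g))"
      using * by auto
    ultimately have "column_pot x y z n j B g \<xi> = column_pot x y z n j B g \<xi>'"
      unfolding column_pot_def by (intro if_cong arg_cong2[where f="(*)"] prod.cong refl) auto
    thus "ennreal (column_pot x y z n j B g \<xi>) = ennreal (column_pot x y z n j B g \<xi>')" by simp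
  qed (use assms in \<open>auto intro!: measurable_compose[OF measurable_column_pot measurable_ennreal]\<close>)
  also have "\<dots> \<le> (\<Prod>g<m. ennreal (exp (- (q + card B * p) / 4)))"
    unfolding p_def q_def
    by (intro prod_mono_ennreal nn_integral_column_pot) (use assms in auto)
  also have "\<dots> = ennreal (exp (- (real m * (q + card B * p)) / 4))"
    by (simp add: ennreal_power algebra_simps flip: exp_of_nat_mult)
  finally show ?thesis .
qed

end

section \<open>The picking sequence\<close>

lemma wps_reach_subset: "wps_reach n m w u A \<Longrightarrow> a < n \<Longrightarrow> A a \<subseteq> {..<m}"
  by (induction rule: wps_reach.induct) auto

lemma wps_reach_finite: "wps_reach n m w u A \<Longrightarrow> finite (A a)"
  by (induction rule: wps_reach.induct) auto

text \<open>If \<open>a\<close> has picked, her count minus one is her count just before her latest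
  pick. At that moment her ratio was minimal, and since then the count of \<open>b\<close> can only
  have grown.\<close>

lemma wps_reach_pace:
  assumes "wps_reach n m w u A" and w: "\<And>a. a < n \<Longrightarrow> 0 < w a"
    and "a < n" "b < n"
  shows "(real (card (A a)) - 1) / w a \<le> real (card (A b)) / w b"
  using assms(1,3,4)
proof (induction arbitrary: a b rule: wps_reach.induct)
  case init
  thus ?case using w[of a] w[of b] by simp
next
  case (step A i g a b)
  have card_i: "card (insert g (A i)) = Suc (card (A i))"
    using step.hyps wps_reach_finite by auto
  have mono: "real (card (A b)) / w b \<le> real (card ((A(i := insert g (A i))) b)) / w b"
    using card_i w[OF step.prems(2)] by (auto simp: divide_right_mono)
  show ?case
  proof (cases "a = i")
    case True
    thus ?thesis using step.hyps(3) step.prems(2) card_i mono by fastforce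
  next
    case False
    thus ?thesis using step.IH[OF step.prems] mono by simp
  qed
qed

lemma wps_reach_card_le:
  assumes "wps_reach n m w u A" and w: "\<And>a. a < n \<Longrightarrow> 0 < w a"
    and C: "\<And>a b. a < n \<Longrightarrow> b < n \<Longrightarrow> w a \<le> C * w b" and ab: "a < n" "b < n"
  shows "real (card (A a)) \<le> 1 + C * real (card (A b))"
proof -
  have "(real (card (A a)) - 1) / w a \<le> real (card (A b)) / w b"
    using wps_reach_pace[OF assms(1) w ab] .
  hence "real (card (A a)) - 1 \<le> (w a / w b) * real (card (A b))"
    using w[OF ab(1)] by (simp add: pos_divide_le_eq mult.commute)
  also have "\<dots> \<le> C * real (card (A b))"
    using C[OF ab] w[OF ab(2)] by (intro mult_right_mono) (auto simp: pos_divide_le_eq)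
  finally show ?thesis by simp
qed

text \<open>When an agent first takes an item worth at most \<open>c\<close> to her, it is her best
  remaining one, so everything she values above \<open>c\<close> is gone already, and taken items
  stay taken.\<close>

lemma wps_reach_exhausted:
  assumes "wps_reach n m w u A" "a < n" "\<not> A a \<subseteq> {g. c < u a g}" "h < m" "c < u a h"
  shows "h \<in> (\<Union>j<n. A j)"
  using assms
proof (induction arbitrary: a rule: wps_reach.induct)
  case init
  thus ?case by simp
next
  case (step A i g a)
  have mono: "(\<Union>j<n. A j) \<subseteq> (\<Union>j<n. (A(i := insert g (A i))) j)" by auto
  show ?case
  proof (cases "\<not> A a \<subseteq> {g. c < u a g}")
    case True
    thus ?thesis using step.IH step.prems mono by blast
  next
    case False
    hence "a = i" "u i g \<le> c" using step.prems by (auto split: if_splits)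
    have "h \<in> (\<Union>j<n. A j)"
    proof (rule ccontr)
      assume "h \<notin> (\<Union>j<n. A j)"
      hence "u i h \<le> u i g" using step.hyps(5) step.prems(3) by auto
      thus False using \<open>a = i\<close> \<open>u i g \<le> c\<close> step.prems(4) by simp
    qed
    thus ?thesis using mono by blast
  qed
qed

section \<open>Early picks are favourites: certificates of depletion\<close>

text \<open>The least fixed point collects the agents who took an item of \<open>U\<close> that is not among their
  own favourites \<open>L\<close>; such an agent had run out of favourites, which therefore join \<open>U\<close>.\<close>

lemma ex_depletion_certificate:
  fixes A L S :: "nat \<Rightarrow> nat set"
  assumes j: "j < n"
    and sub: "\<And>a. a < n \<Longrightarrow> A a \<subseteq> {..<m}"
    and card: "\<And>a. a < n \<Longrightarrow> card (A a) \<le> r"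
    and S: "\<And>a. a < n \<Longrightarrow> A a \<subseteq> S a"
    and exhausted: "\<And>a. a < n \<Longrightarrow> \<not> A a \<subseteq> L a \<Longrightarrow> L a \<inter> {..<m} \<subseteq> (\<Union>a<n. A a)"
    and depleted: "S j \<inter> {..<m} \<subseteq> (\<Union>a<n. A a)"
  obtains B U where "B \<subseteq> {..<n} - {j}" "U = S j \<union> (\<Union>b\<in>B. L b)"
    "\<And>b. b \<in> B \<Longrightarrow> \<exists>g<m. g \<in> U \<and> g \<in> S b \<and> g \<notin> L b"
    "card {g. g < m \<and> g \<in> U \<and> (\<forall>a\<in>{..<n} - insert j B. g \<notin> L a)} \<le> (card B + 1) * r"
proof -
  define \<Gamma> where "\<Gamma> = (\<lambda>B. {b \<in> {..<n} - {j}. \<not> A b \<inter> (S j \<union> (\<Union>b\<in>B. L b)) \<subseteq> L b})"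
  define B where "B = lfp \<Gamma>"
  define U where "U = S j \<union> (\<Union>b\<in>B. L b)"
  have "mono \<Gamma>" unfolding \<Gamma>_def by (intro monoI) blast
  hence "B = \<Gamma> B" unfolding B_def by (rule lfp_unfold)
  hence B: "b \<in> B \<longleftrightarrow> b < n \<and> b \<noteq> j \<and> \<not> A b \<inter> U \<subseteq> L b" for b
    unfolding \<Gamma>_def U_def by blast
  have B_sub: "B \<subseteq> {..<n} - {j}" using B by auto
  have finB: "finite B" using B_sub finite_subset by blast
  have hit: "\<exists>g<m. g \<in> U \<and> g \<in> S b \<and> g \<notin> L b" if "b \<in> B" for b
  proof -
    from that obtain g where "b < n" "g \<in> A b" "g \<in> U" "g \<notin> L b" using B by auto
    thus ?thesis using sub[of b] S[of b] by auto
  qed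
  let ?V = "{g. g < m \<and> g \<in> U \<and> (\<forall>a\<in>{..<n} - insert j B. g \<notin> L a)}"
  \<comment> \<open>All relevant items are gone: those of \<open>S j\<close> by
    \<open>depleted\<close>, those of \<open>L b\<close> for \<open>b\<close> in \<open>B\<close> by
    \<open>exhausted\<close>. A taker outside \<open>insert j B\<close> is not in the fixed point,
    so she took the item as one of her own favourites. Items that are nobody's favourite outside
    \<open>insert j B\<close> were therefore taken by \<open>insert j B\<close>, with at most
    \<open>r\<close> picks each.\<close>
  have "?V \<subseteq> (\<Union>b\<in>insert j B. A b)"
  proof
    fix g assume g: "g \<in> ?V"
    have "g \<in> (\<Union>a<n. A a)"
    proof (cases "g \<in> S j")
      case True
      thus ?thesis using depleted g by auto
    next
      case False
      then obtain b where b: "b \<in> B" "g \<in> L b" using g by (auto simp: U_def)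
      hence "\<not> A b \<subseteq> L b" "b < n" using B[of b] by auto
      thus ?thesis using exhausted[of b] b g by auto
    qed
    then obtain a where a: "a < n" "g \<in> A a" by auto
    show "g \<in> (\<Union>b\<in>insert j B. A b)"
    proof (cases "a \<in> insert j B")
      case False
      hence "g \<in> L a" using B[of a] a g by auto
      thus ?thesis using g a False by auto
    qed (use a in auto)
  qed
  moreover have fin: "finite (\<Union>b\<in>insert j B. A b)"
    using finB sub B_sub j by (auto intro!: finite_subset[OF sub])
  ultimately have "card ?V \<le> card (\<Union>b\<in>insert j B. A b)" by (rule card_mono[rotated])
  also have "\<dots> \<le> (\<Sum>b\<in>insert j B. card (A b))" using finB by (intro card_UN_le) auto
  also have "\<dots> \<le> (\<Sum>b\<in>insert j B. r)" using B_sub j by (intro sum_mono card) auto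
  also have "\<dots> = (card B + 1) * r"
  proof -
    have "j \<notin> B" using B_sub by auto
    thus ?thesis using finB by simp
  qed
  finally show ?thesis using that[OF B_sub U_def hit] by blast
qed

text \<open>Consider the first pick that is worth at most \<open>1 - y\<close> to its picker
  \<open>j\<close>. Just before it all her items above \<open>1 - y\<close> are gone, while all
  earlier picks are above their pickers' thresholds. This state yields a depletion certificate,
  whose product potential contradicts \<open>no_cert\<close>. The weight \<open>z\<close> may depend
  on \<open>B\<close> so that it can be tuned to its size.\<close>

lemma wps_reach_picks_high:
  assumes reach: "wps_reach n m w (util_of \<omega>) A"
    and card: "\<And>a. a < n \<Longrightarrow> card (A a) \<le> r"
    and z: "\<And>B. z B \<ge> (1::real)"
    and no_cert: "\<And>j B. j < n \<Longrightarrow> B \<subseteq> {..<n} - {j} \<Longrightarrow>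
        (\<Prod>g<m. column_pot x y (z B) n j B g \<omega>) < z B ^ card B * (1/8) ^ ((card B + 1) * r)"
    and "a < n" "g \<in> A a"
  shows "1 - y < \<omega> (a, g)"
  using reach card assms(5,6)
proof (induction arbitrary: a g rule: wps_reach.induct)
  case init
  thus ?case by simp
next
  case (step A j h)
  define S where "S = (\<lambda>a. {g. 1 - y < \<omega> (a, g)})"
  define L where "L = (\<lambda>a. {g. 1 - x < \<omega> (a, g)})"
  have cardA: "card (A a) \<le> r" if "a < n" for a
  proof -
    have "card (A a) \<le> card ((A(j := insert h (A j))) a)"
      using wps_reach_finite[OF step.hyps(1)] by (auto intro!: card_mono)
    also have "\<dots> \<le> r" by (rule step.prems(1)[OF that])
    finally show ?thesis .
  qed
  have IH: "A a \<subseteq> S a" if "a < n" for a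
    using step.IH[OF cardA that] by (auto simp: S_def)
  have "h \<in> S j"
  proof (rule ccontr)
    assume h: "h \<notin> S j"
    have dep: "S j \<inter> {..<m} \<subseteq> (\<Union>a<n. A a)"
    proof
      fix g assume g: "g \<in> S j \<inter> {..<m}"
      show "g \<in> (\<Union>a<n. A a)"
      proof (rule ccontr)
        assume "g \<notin> (\<Union>a<n. A a)"
        hence "\<omega> (j, g) \<le> \<omega> (j, h)" using step.hyps(5) g by (auto simp: util_of_def)
        thus False using g h by (auto simp: S_def)
      qed
    qed
    have exh: "L a \<inter> {..<m} \<subseteq> (\<Union>a<n. A a)" if "a < n" "\<not> A a \<subseteq> L a" for a
      using wps_reach_exhausted[OF step.hyps(1) that(1), of "1 - x"] that(2)
      by (auto simp: L_def util_of_def)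
    show False
    proof (rule ex_depletion_certificate[OF step.hyps(2) wps_reach_subset[OF step.hyps(1)] cardA IH exh dep])
      fix B U
      assume BU: "B \<subseteq> {..<n} - {j}" "U = S j \<union> (\<Union>b\<in>B. L b)"
        "\<And>b. b \<in> B \<Longrightarrow> \<exists>g<m. g \<in> U \<and> g \<in> S b \<and> g \<notin> L b"
        "card {g. g < m \<and> g \<in> U \<and> (\<forall>a\<in>{..<n} - insert j B. g \<notin> L a)} \<le> (card B + 1) * r"
      have "z B ^ card B * (1/8) ^ ((card B + 1) * r) \<le> (\<Prod>g<m. column_pot x y (z B) n j B g \<omega>)"
      proof (rule prod_column_pot_ge[where U=U])
        show "finite B" using BU(1) finite_subset by blast
      qed (use BU(2-4) z in \<open>auto simp: S_def L_def not_less\<close>)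
      thus False using no_cert[OF step.hyps(2) BU(1)] by simp
    qed
  qed
  thus ?case using IH step.prems by (auto simp: S_def split: if_splits)
qed

section \<open>Envy between two agents\<close>

lemma sum_list_map_mono_take:
  fixes xs vs :: "real list"
  assumes "list_all2 (\<le>) vs xs"
  shows "sum_list (take t xs) - sum_list (take t vs) \<le> sum_list xs - sum_list vs"
  using assms
proof (induction arbitrary: t rule: list_all2_induct)
  case (Cons v vs x xs)
  have "sum_list vs \<le> sum_list xs"
    using Cons.IH[of 0] by simp
  thus ?case using Cons.hyps Cons.IH[of "t - 1"] by (cases t) auto
qed simp

text \<open>Here \<open>gs\<close> lists agent \<open>j\<close>'s picks, \<open>es\<close> the value of agent \<open>i\<close>'s latest pick at each of them (1 if there is
  none) and \<open>x\<close> that value now. The last conjunct survives a pick of \<open>i\<close> because the bracket is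
  nonnegative (\<open>wps_reach_pace\<close>), and a pick of \<open>j\<close> because both sides of it move by \<open>x / w j\<close>.\<close>

definition pair_history ::
  "nat \<Rightarrow> nat \<Rightarrow> (nat \<Rightarrow> real) \<Rightarrow> (nat \<Rightarrow> nat \<Rightarrow> real) \<Rightarrow> nat \<Rightarrow> nat \<Rightarrow> nat \<Rightarrow> nat set
    \<Rightarrow> (nat \<Rightarrow> nat set) \<Rightarrow> nat list \<Rightarrow> real list \<Rightarrow> real \<Rightarrow> bool" where
  "pair_history n m w u i j t H A gs es x \<longleftrightarrow> set gs = A j \<and> distinct gs \<and> sorted_wrt (\<lambda>g h. u j h \<le> u j g) gs \<and>
    set (take t gs) \<subseteq> H \<and> list_all2 (\<lambda>g e. u i g \<le> e) gs es \<and> sorted_wrt (\<ge>) es \<and>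
    (\<forall>e\<in>set es. x \<le> e \<and> e \<le> 1) \<and> 0 \<le> x \<and> x \<le> 1 \<and>
    (\<forall>h\<in>{..<m} - (\<Union>a<n. A a). u i h \<le> x \<and> (\<forall>g\<in>set gs. u j h \<le> u j g)) \<and>
    (sum_list es - 1) / w j + x * (card (A i) / w i - (real (card (A j)) - 1) / w j) \<le> (\<Sum>g\<in>A i. u i g) / w i"

lemma wps_reach_pair_history:
  assumes reach: "wps_reach n m w u A"
    and ij: "i < n" "j < n" "i \<noteq> j"
    and w: "\<And>a. a < n \<Longrightarrow> 0 < w a"
    and u: "\<And>g. g < m \<Longrightarrow> 0 \<le> u i g \<and> u i g \<le> 1"
    and high: "\<And>A'. wps_reach n m w u A' \<Longrightarrow> card (A' j) \<le> t \<Longrightarrow> A' j \<subseteq> H"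
  shows "\<exists>gs es x. pair_history n m w u i j t H A gs es x"
  using reach
proof (induction rule: wps_reach.induct)
  case init
  \<comment> \<open>Before any pick of \<open>i\<close> the bound 1 on utilities serves as
    \<open>x\<close>. With this value the two occurrences of \<open>- 1\<close> in the inequality
    cancel, and it reads \<open>0 \<le> 0\<close>.\<close>
  have "pair_history n m w u i j t H (\<lambda>_. {}) [] [] 1"
    using u by (auto simp: pair_history_def)
  thus ?case by (intro exI)
next
  case (step A a h)
  let ?A = "A(a := insert h (A a))"
  obtain gs es x where "pair_history n m w u i j t H A gs es x"
    using step.IH by blast
  hence IH: "set gs = A j" "distinct gs" "sorted_wrt (\<lambda>g h. u j h \<le> u j g) gs"
    "set (take t gs) \<subseteq> H" "list_all2 (\<lambda>g e. u i g \<le> e) gs es" "sorted_wrt (\<ge>) es"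
    "\<And>e. e \<in> set es \<Longrightarrow> x \<le> e \<and> e \<le> 1" "0 \<le> x" "x \<le> 1"
    "\<And>h. h \<in> {..<m} - (\<Union>a<n. A a) \<Longrightarrow> u i h \<le> x \<and> (\<forall>g\<in>set gs. u j h \<le> u j g)"
    "(sum_list es - 1) / w j + x * (card (A i) / w i - (real (card (A j)) - 1) / w j) \<le> (\<Sum>g\<in>A i. u i g) / w i"
    by (simp_all add: pair_history_def)
  have reach': "wps_reach n m w u ?A" using step.hyps by (rule wps_reach.step)
  have h: "h < m" "h \<notin> A a" "h \<in> {..<m} - (\<Union>a<n. A a)" using step.hyps by auto
  have fin: "finite (A a)" using wps_reach_finite[OF step.hyps(1)] .
  have remaining: "h' \<in> {..<m} - (\<Union>a<n. A a)" if "h' \<in> {..<m} - (\<Union>b<n. ?A b)" for h'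
    using that by (auto split: if_splits)
  have wpos: "0 < w i" "0 < w j" using w ij by auto
  consider "a = j" | "a = i" | "a \<noteq> i" "a \<noteq> j" by blast
  thus ?case
  proof cases
    case 1
    have len: "length gs = card (A j)" using IH(1,2) distinct_card by metis
    \<comment> \<open>While the list is shorter than \<open>t\<close>, the new state still has at
      most \<open>t\<close> picks of \<open>j\<close> and \<open>high\<close> applies to it. Later
      picks do not change the first \<open>t\<close> entries.\<close>
    have take_H: "set (take t (gs @ [h])) \<subseteq> H"
    proof (cases "length gs < t")
      case True
      hence "card (?A j) \<le> t" using 1 len fin h by simp
      hence "?A j \<subseteq> H" using high[OF reach'] by blast
      thus ?thesis using IH(1) 1 True by auto
    next
      case False
      thus ?thesis using IH(4) by simp
    qed
    have u_h: "u j h' \<le> u j h" "u i h' \<le> x" if "h' \<in> {..<m} - (\<Union>b<n. ?A b)" for h'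
      using remaining[OF that] step.hyps(5) 1 IH(10) by auto
    have ineq: "(sum_list (es @ [x]) - 1) / w j + x * (card (?A i) / w i - (real (card (?A j)) - 1) / w j)
        \<le> (\<Sum>g\<in>?A i. u i g) / w i"
    proof -
      have "?A i = A i" "card (?A j) = Suc (card (A j))" using 1 ij fin h by auto
      thus ?thesis using IH(11) wpos by (simp add: field_simps)
    qed
    have "pair_history n m w u i j t H ?A (gs @ [h]) (es @ [x]) x"
      unfolding pair_history_def
    proof (intro conjI ballI)
      show "set (gs @ [h]) = ?A j" using IH(1) 1 by simp
      show "distinct (gs @ [h])" using IH(1,2) 1 h(2) by simp
      show "sorted_wrt (\<lambda>g h. u j h \<le> u j g) (gs @ [h])"
        using IH(3) IH(10)[OF h(3)] by (simp add: sorted_wrt_append)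
      show "list_all2 (\<lambda>g e. u i g \<le> e) (gs @ [h]) (es @ [x])"
        using IH(5) IH(10)[OF h(3)] by (intro list_all2_appendI) simp_all
      show "sorted_wrt (\<ge>) (es @ [x])" using IH(6,7) by (simp add: sorted_wrt_append)
    next
      fix h' g assume h': "h' \<in> {..<m} - (\<Union>a<n. ?A a)" and g: "g \<in> set (gs @ [h])"
      thus "u j h' \<le> u j g" using u_h(1)[OF h'] IH(10)[OF remaining[OF h']] by auto
    next
      fix h' assume h': "h' \<in> {..<m} - (\<Union>a<n. ?A a)"
      thus "u i h' \<le> x" by (rule u_h(2))
    qed (use IH(7-9) take_H ineq in auto)
    thus ?thesis by (intro exI)
  next
    case 2
    define D where "D = card (A i) / w i - (real (card (A j)) - 1) / w j"
    have D0: "0 \<le> D" using wps_reach_pace[OF step.hyps(1) w ij(2,1)] by (simp add: D_def)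
    have ux: "u i h \<le> x" "0 \<le> u i h" "u i h \<le> 1" using IH(10)[OF h(3)] u h by auto
    have ineq: "(sum_list es - 1) / w j + u i h * (card (?A i) / w i - (real (card (?A j)) - 1) / w j)
        \<le> (\<Sum>g\<in>?A i. u i g) / w i"
    proof -
      have "?A j = A j" "card (?A i) = Suc (card (A i))" "(\<Sum>g\<in>?A i. u i g) = u i h + (\<Sum>g\<in>A i. u i g)"
        using 2 ij fin h by auto
      \<comment> \<open>The increase of the count of \<open>i\<close> contributes exactly
        \<open>u i h / w i\<close>, which is also the gain in weighted utility. What remains is to
        lower \<open>x\<close> to \<open>u i h\<close> in front of the nonnegative
        \<open>D\<close>.\<close>
      hence "(sum_list es - 1) / w j + u i h * (card (?A i) / w i - (real (card (?A j)) - 1) / w j)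
        = (sum_list es - 1) / w j + u i h * D + u i h / w i"
        using wpos by (simp add: D_def field_simps)
      also have "\<dots> \<le> (sum_list es - 1) / w j + x * D + u i h / w i"
        using ux D0 by (simp add: mult_right_mono)
      also have "\<dots> \<le> (\<Sum>g\<in>A i. u i g) / w i + u i h / w i" using IH(11) by (simp add: D_def)
      also have "\<dots> = (\<Sum>g\<in>?A i. u i g) / w i"
        using \<open>(\<Sum>g\<in>?A i. u i g) = _\<close> by (simp add: add_divide_distrib)
      finally show ?thesis .
    qed
    have "pair_history n m w u i j t H ?A gs es (u i h)"
      unfolding pair_history_def
    proof (intro conjI ballI)
      show "set gs = ?A j" using IH(1) 2 ij by simp
      show "u i h \<le> e" if "e \<in> set es" for e using IH(7)[OF that] ux by simp
      fix h' assume h': "h' \<in> {..<m} - (\<Union>a<n. ?A a)"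
      show "u i h' \<le> u i h" using remaining[OF h'] step.hyps(5) 2 by blast
      show "u j h' \<le> u j g" if "g \<in> set gs" for g using IH(10)[OF remaining[OF h']] that by blast
    qed (use IH(2-7) ux ineq in auto)
    thus ?thesis by (intro exI)
  next
    case 3
    have "pair_history n m w u i j t H ?A gs es x"
      unfolding pair_history_def
    proof (intro conjI ballI)
      show "set gs = ?A j" using IH(1) 3 by simp
      fix h' assume h': "h' \<in> {..<m} - (\<Union>a<n. ?A a)"
      show "u i h' \<le> x" using IH(10)[OF remaining[OF h']] by blast
      show "u j h' \<le> u j g" if "g \<in> set gs" for g using IH(10)[OF remaining[OF h']] that by blast
    qed (use IH(2-9) IH(11) 3 in auto)
    thus ?thesis by (intro exI)
  qed
qed

text \<open>The witness is the list of the first \<open>t\<close> picks of \<open>j\<close>. Envy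
  makes the total gap between \<open>es\<close> and the values for \<open>i\<close> less than 1, so
  the gap over this prefix is at most 1, and the running maximum adds at most 1: hence the bound 2.
  For \<open>j\<close> the same picks decrease within the interval from \<open>1 - y\<close> to 1,
  hence the bound \<open>y\<close>.\<close>

lemma wps_reach_envy_list:
  assumes reach: "wps_reach n m w u A"
    and ij: "i < n" "j < n" "i \<noteq> j"
    and w: "\<And>a. a < n \<Longrightarrow> 0 < w a"
    and u: "\<And>a g. a < n \<Longrightarrow> g < m \<Longrightarrow> 0 \<le> u a g \<and> u a g \<le> 1"
    and high: "\<And>A' g. wps_reach n m w u A' \<Longrightarrow> card (A' j) \<le> t \<Longrightarrow> g \<in> A' j \<Longrightarrow> 1 - y < u j g"
    and y: "0 \<le> y" and t: "t \<le> card (A j)"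
    and envy: "(\<Sum>g\<in>A i. u i g) / w i < (\<Sum>g\<in>A j. u i g) / w j"
  obtains gs where "length gs = t" "distinct gs" "set gs \<subseteq> {..<m}"
    "dev (next_or (1 - y)) (map (u j) gs) \<le> y" "dev max_list0 (map (u i) gs) \<le> 2"
proof -
  have "\<exists>gs es x. pair_history n m w u i j t {g. 1 - y < u j g} A gs es x"
    by (rule wps_reach_pair_history[OF reach ij w]) (use u[OF ij(1)] high in auto)
  then obtain gs es x where "pair_history n m w u i j t {g. 1 - y < u j g} A gs es x" by blast
  hence gs: "set gs = A j" "distinct gs" "sorted_wrt (\<lambda>g h. u j h \<le> u j g) gs"
    "set (take t gs) \<subseteq> {g. 1 - y < u j g}" "list_all2 (\<lambda>g e. u i g \<le> e) gs es" "sorted_wrt (\<ge>) es"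
    "\<And>e. e \<in> set es \<Longrightarrow> x \<le> e \<and> e \<le> 1" "0 \<le> x" "x \<le> 1"
    "(sum_list es - 1) / w j + x * (card (A i) / w i - (real (card (A j)) - 1) / w j) \<le> (\<Sum>g\<in>A i. u i g) / w i"
    by (simp_all add: pair_history_def)
  have sub: "set gs \<subseteq> {..<m}" using gs(1) wps_reach_subset[OF reach ij(2)] by simp
  have sub_t: "set (take t gs) \<subseteq> {..<m}" using sub set_take_subset by fastforce
  have len: "length (take t gs) = t" using t gs(1,2) distinct_card by fastforce
  have "0 \<le> x * (card (A i) / w i - (real (card (A j)) - 1) / w j)"
    using gs(8) wps_reach_pace[OF reach w ij(2,1)] by simp
  hence "(sum_list es - 1) / w j < (\<Sum>g\<in>A j. u i g) / w j" using gs(10) envy by linarith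
  also have "(\<Sum>g\<in>A j. u i g) = sum_list (map (u i) gs)"
    using gs(1,2) by (simp add: sum_list_distinct_conv_sum_set)
  finally have gap: "sum_list es - sum_list (map (u i) gs) < 1"
    using w[OF ij(2)] by (simp add: divide_less_cancel)
  have la: "list_all2 (\<le>) (map (u i) gs) es"
    using gs(5) by (simp add: list_all2_map1)
  have la_t: "list_all2 (\<lambda>v e. 0 \<le> v \<and> v \<le> e) (map (u i) (take t gs)) (take t es)"
    using list_all2_takeI[OF gs(5), of t] sub_t u[OF ij(1)]
    by (auto simp: list_all2_map1 list_all2_conv_all_nth subset_iff set_conv_nth)
  have "dev max_list0 (map (u i) (take t gs))
      \<le> max_list0 (map (u i) (take t gs)) + (sum_list (take t es) - sum_list (map (u i) (take t gs)))"
    by (rule dev_max_list0[OF la_t]) (use gs(6) in \<open>simp add: sorted_wrt_take\<close>)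
  also have "max_list0 (map (u i) (take t gs)) \<le> 1"
    using sub_t u[OF ij(1)] by (intro max_list0_ub) (auto simp: subset_iff)
  also have "sum_list (take t es) - sum_list (map (u i) (take t gs)) \<le> 1"
    using sum_list_map_mono_take[OF la, of t] gap by (simp add: take_map)
  finally have dev_i: "dev max_list0 (map (u i) (take t gs)) \<le> 2" by simp
  have "dev (next_or (1 - y)) (map (u j) (take t gs)) = next_or (1 - y) (map (u j) (take t gs)) - (1 - y)"
    using gs(3,4) by (intro dev_next_or) (auto simp: sorted_wrt_map sorted_wrt_take subset_iff less_imp_le)
  also have "\<dots> \<le> y"
  proof (cases "take t gs")
    case (Cons g gs')
    hence "g < m" using sub_t by auto
    thus ?thesis using Cons u[OF ij(2), of g] by (simp add: next_or_def)
  next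
    case Nil
    show ?thesis unfolding Nil using y by (simp add: next_or_def)
  qed
  finally show ?thesis
    using that[of "take t gs"] len gs(2) sub_t dev_i by (simp add: distinct_take)
qed

text \<open>All items are allocated and every agent's count is controlled by that of
  \<open>j\<close>. Thus a large \<open>m\<close> forces every agent to make many picks.\<close>

lemma wps_outcome_card_ge:
  assumes "wps_outcome n m w u A" and w: "\<And>a. a < n \<Longrightarrow> 0 < w a"
    and C: "\<And>a b. a < n \<Longrightarrow> b < n \<Longrightarrow> w a \<le> C * w b" and j: "j < n"
  shows "real m \<le> real n * (1 + C * real (card (A j)))"
proof -
  have reach: "wps_reach n m w u A" and all: "{..<m} \<subseteq> (\<Union>j<n. A j)"
    using assms(1) by (auto simp: wps_outcome_def)
  have "m = card {..<m}" by simp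
  also have "\<dots> \<le> card (\<Union>a<n. A a)"
    using all wps_reach_finite[OF reach] by (intro card_mono) auto
  also have "\<dots> \<le> (\<Sum>a<n. card (A a))" by (intro card_UN_le) auto
  finally have "real m \<le> (\<Sum>a<n. real (card (A a)))" by (simp flip: of_nat_sum)
  also have "\<dots> \<le> (\<Sum>a<n. 1 + C * real (card (A j)))"
    using wps_reach_card_le[OF reach w C _ j] by (intro sum_mono) auto
  finally show ?thesis by simp
qed

section \<open>Union bounds\<close>

text \<open>The elementary half of Stirling's formula; the induction uses that
  \<open>(1 + 1/k) ^ k\<close> is at most \<open>exp 1\<close>.\<close>

lemma power_self_le_exp_fact: "real k ^ k \<le> exp 1 ^ k * fact k"
proof (induction k)
  case (Suc k)
  show ?case
  proof (cases "k = 0")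
    case False
    have "real (Suc k) ^ k = real k ^ k * (1 + 1 / real k) ^ k"
      using False by (simp add: field_simps flip: power_mult_distrib)
    also have "\<dots> \<le> (exp 1 ^ k * fact k) * exp 1"
      using Suc exp_ge_one_plus_x_over_n_power_n[of k 1] False by (intro mult_mono) auto
    finally have "real (Suc k) * real (Suc k) ^ k \<le> real (Suc k) * ((exp 1 ^ k * fact k) * exp 1)"
      by (intro mult_left_mono) auto
    thus ?thesis by (simp add: mult_ac)
  qed simp
qed simp

text \<open>The usual bound of the binomial coefficient by \<open>(exp 1 * n / k) ^ k\<close>,
  multiplied out so that \<open>k = 0\<close> is covered. The factor \<open>k ^ k\<close> is the one
  left over from the hit weights.\<close>

lemma binomial_mult_power_self_le: "real (n choose k) * real k ^ k \<le> (exp 1 * real n) ^ k"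
proof -
  have "real (n choose k) * real k ^ k \<le> real (n choose k) * (exp 1 ^ k * fact k)"
    by (intro mult_left_mono power_self_le_exp_fact) auto
  also have "\<dots> = exp 1 ^ k * real ((n choose k) * fact k)" by simp
  also have "\<dots> \<le> exp 1 ^ k * real (n ^ k)"
    by (intro mult_left_mono of_nat_mono binomial_fact_pow) auto
  finally show ?thesis by (simp add: power_mult_distrib)
qed

lemma sum_Pow_card:
  fixes h :: "nat \<Rightarrow> real"
  assumes "finite S"
  shows "(\<Sum>B\<in>Pow S. h (card B)) = (\<Sum>k\<le>card S. real (card S choose k) * h k)"
proof -
  have "(\<Sum>B\<in>Pow S. h (card B)) = (\<Sum>k\<le>card S. \<Sum>B\<in>{B \<in> Pow S. card B = k}. h (card B))"
    using assms by (intro sum.group[symmetric]) (auto intro: card_mono)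
  also have "\<dots> = (\<Sum>k\<le>card S. real (card S choose k) * h k)"
  proof (intro sum.cong refl)
    fix k
    have "card {B \<in> Pow S. card B = k} = card S choose k"
      using n_subsets[OF assms, of k] by (simp add: Pow_def)
    thus "(\<Sum>B\<in>{B \<in> Pow S. card B = k}. h (card B)) = real (card S choose k) * h k" by simp
  qed
  finally show ?thesis .
qed

lemma (in prob_space) markov_nn_integral:
  fixes h :: "'a \<Rightarrow> real"
  assumes [measurable]: "h \<in> borel_measurable M" and c: "0 < c" and b: "0 \<le> b"
    and le: "(\<integral>\<^sup>+ \<xi>. ennreal (h \<xi>) \<partial>M) \<le> ennreal b"
  shows "prob {\<xi> \<in> space M. c \<le> h \<xi>} \<le> b / c"
proof -
  have "emeasure M {\<xi> \<in> space M. c \<le> h \<xi>} \<le> emeasure M {\<xi> \<in> space M. 1 \<le> ennreal (1/c) * ennreal (h \<xi>)}"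
  proof (intro emeasure_mono subsetI; (elim CollectE conjE)?)
    fix \<xi> assume "\<xi> \<in> space M" "c \<le> h \<xi>"
    moreover from this c have "1 \<le> 1/c * h \<xi>" by (simp add: field_simps)
    ultimately show "\<xi> \<in> {\<xi> \<in> space M. 1 \<le> ennreal (1/c) * ennreal (h \<xi>)}"
      using c by (simp flip: ennreal_mult)
  qed measurable
  also have "\<dots> \<le> ennreal (1/c) * (\<integral>\<^sup>+ \<xi>. ennreal (h \<xi>) * indicator (space M) \<xi> \<partial>M)"
    by (rule nn_integral_Markov_inequality) auto
  also have "(\<integral>\<^sup>+ \<xi>. ennreal (h \<xi>) * indicator (space M) \<xi> \<partial>M) = (\<integral>\<^sup>+ \<xi>. ennreal (h \<xi>) \<partial>M)"
    by (intro nn_integral_cong) auto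
  also have "ennreal (1/c) * (\<integral>\<^sup>+ \<xi>. ennreal (h \<xi>) \<partial>M) \<le> ennreal (1/c) * ennreal b"
    using le by (intro mult_left_mono) auto
  also have "\<dots> = ennreal (b / c)" using b c by (simp flip: ennreal_mult)
  finally show ?thesis using b c by (simp add: emeasure_eq_measure)
qed

text \<open>The weight \<open>1 / (5kq)\<close> for \<open>k\<close> agents makes the hits worth a factor \<open>(5kq)^k\<close>, which turns the
  \<open>n choose k\<close> sets of \<open>k\<close> agents into only \<open>(5enq)^k\<close>. For \<open>k = 0\<close> the division by zero gives weight 1.\<close>

definition hit_weight :: "real \<Rightarrow> nat set \<Rightarrow> real" where
  "hit_weight q B = max 1 (1 / (5 * real (card B) * q))"

definition depletion_index :: "nat \<Rightarrow> (nat \<times> nat set) set" where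
  "depletion_index n = (SIGMA j:{..<n}. Pow ({..<n} - {j}))"

definition envy_index :: "nat \<Rightarrow> nat \<Rightarrow> nat \<Rightarrow> (nat \<times> nat \<times> nat list) set" where
  "envy_index n m t = {(i, j, gs). i < n \<and> j < n \<and> i \<noteq> j \<and> distinct gs \<and> set gs \<subseteq> {..<m} \<and> length gs = t}"

lemma finite_depletion_index: "finite (depletion_index n)"
  unfolding depletion_index_def by auto

lemma envy_index_subset: "envy_index n m t \<subseteq> {..<n} \<times> {..<n} \<times> {gs. set gs \<subseteq> {..<m} \<and> length gs = t}"
  by (auto simp: envy_index_def)

lemma finite_envy_index: "finite (envy_index n m t)"
  by (rule finite_subset[OF envy_index_subset]) (auto intro!: finite_lists_length_eq)

lemma card_envy_index: "card (envy_index n m t) \<le> n * n * m ^ t"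
proof -
  have "card (envy_index n m t) \<le> card ({..<n} \<times> {..<n} \<times> {gs. set gs \<subseteq> {..<m} \<and> length gs = t})"
    by (rule card_mono[OF _ envy_index_subset]) (auto intro!: finite_lists_length_eq)
  also have "\<dots> = n * n * m ^ t" by (simp add: card_cartesian_product card_lists_length_eq)
  finally show ?thesis .
qed

lemma util_of_row: "util_of \<omega> a = (\<lambda>g. \<omega> (a, g))"
  by (rule ext) (simp add: util_of_def)

text \<open>With \<open>L = ln n\<close>, \<open>LL = ln L\<close> and \<open>l = L / LL\<close>:
  \<open>36 * C \<le> LL\<close> gives \<open>8 ^ r \<le> n\<close>, \<open>LL / n \<le> 1\<close>
  makes the threshold \<open>y\<close> small, \<open>LL * exp (- l) \<le> 1/2\<close> gives a
  geometric series over the sets \<open>B\<close>, and the bound by \<open>exp (- LL / 2)\<close>,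
  which is \<open>1 / sqrt L\<close>, controls the envy events.\<close>

lemma eventually_WEF_parameters:
  fixes C c \<epsilon> :: real
  assumes "C > 0" "c > 0" "\<epsilon> > 0"
  shows "eventually (\<lambda>n::nat. 1 \<le> ln (ln (real n)) \<and> 36 * C \<le> ln (ln (real n)) \<and>
     1 \<le> ln (real n) / ln (ln (real n)) \<and> ln (ln (real n)) / real n \<le> 1 \<and>
     ln (ln (real n)) * exp (- (ln (real n) / ln (ln (real n)))) \<le> 1/2 \<and>
     c * ((ln (ln (real n)))\<^sup>2 / ln (real n)) \<le> exp (- ln (ln (real n)) / 2) \<and>
     3 / (real n)\<^sup>2 \<le> \<epsilon> \<and> 0 < n) at_top"
proof (intro eventually_conj)
  have lim: "filterlim (\<lambda>n::nat. ln (ln (real n))) at_top at_top" by real_asymp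
  show "eventually (\<lambda>n::nat. 1 \<le> ln (ln (real n))) at_top" "eventually (\<lambda>n::nat. 36 * C \<le> ln (ln (real n))) at_top"
    using lim unfolding filterlim_at_top by blast+
  have "filterlim (\<lambda>n::nat. ln (real n) / ln (ln (real n))) at_top at_top" by real_asymp
  thus "eventually (\<lambda>n::nat. 1 \<le> ln (real n) / ln (ln (real n))) at_top" unfolding filterlim_at_top by blast
  have "(\<lambda>n::nat. ln (ln (real n)) / real n) \<longlonglongrightarrow> 0" by real_asymp
  from order_tendstoD(2)[OF this, of 1]
  show "eventually (\<lambda>n::nat. ln (ln (real n)) / real n \<le> 1) at_top"
    by (auto elim: eventually_mono)
  have "(\<lambda>n::nat. ln (ln (real n)) * exp (- (ln (real n) / ln (ln (real n))))) \<longlonglongrightarrow> 0" by real_asymp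
  from order_tendstoD(2)[OF this, of "1/2"]
  show "eventually (\<lambda>n::nat. ln (ln (real n)) * exp (- (ln (real n) / ln (ln (real n)))) \<le> 1/2) at_top"
    by (auto elim: eventually_mono)
  have "(\<lambda>n::nat. (ln (ln (real n)))\<^sup>2 / ln (real n) / exp (- ln (ln (real n)) / 2)) \<longlonglongrightarrow> 0" by real_asymp
  from order_tendstoD(2)[OF this, of "1/c"] assms
  have "eventually (\<lambda>n::nat. (ln (ln (real n)))\<^sup>2 / ln (real n) / exp (- ln (ln (real n)) / 2) < 1/c) at_top"
    by simp
  thus "eventually (\<lambda>n::nat. c * ((ln (ln (real n)))\<^sup>2 / ln (real n)) \<le> exp (- ln (ln (real n)) / 2)) at_top"
  proof (rule eventually_mono)
    fix n :: nat
    define A where "A = (ln (ln (real n)))\<^sup>2 / ln (real n)"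
    assume "(ln (ln (real n)))\<^sup>2 / ln (real n) / exp (- ln (ln (real n)) / 2) < 1/c"
    hence "A < 1/c * exp (- ln (ln (real n)) / 2)"
      unfolding A_def[symmetric] by (simp only: pos_divide_less_eq exp_gt_zero)
    thus "c * ((ln (ln (real n)))\<^sup>2 / ln (real n)) \<le> exp (- ln (ln (real n)) / 2)"
      unfolding A_def[symmetric] using assms by (simp add: field_simps)
  qed
  have "(\<lambda>n::nat. 3 / (real n)\<^sup>2) \<longlonglongrightarrow> 0" by real_asymp
  from order_tendstoD(2)[OF this, of \<epsilon>] assms
  show "eventually (\<lambda>n::nat. 3 / (real n)\<^sup>2 \<le> \<epsilon>) at_top" by (auto elim: eventually_mono)
qed (rule eventually_gt_at_top)

section \<open>Failure events and their probabilities\<close>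

context bounded_density
begin

definition depletion_event :: "nat \<Rightarrow> nat \<Rightarrow> nat \<Rightarrow> real \<Rightarrow> real \<Rightarrow> nat \<times> nat set \<Rightarrow> (nat \<times> nat \<Rightarrow> real) set" where
  "depletion_event n m r x y = (\<lambda>(j, B). {\<xi> \<in> space (util_space f n m).
     hit_weight (D.prob {1-y<..}) B ^ card B * (1/8) ^ ((card B + 1) * r)
       \<le> (\<Prod>g<m. column_pot x y (hit_weight (D.prob {1-y<..}) B) n j B g \<xi>)})"

text \<open>The rates \<open>t / y\<close> and \<open>t\<close> match the bounds \<open>y\<close>
  and 2 on the two prediction errors of an envy list: the exponent is then at most
  \<open>t + 2 * t\<close>, which explains the threshold.\<close>

definition envy_event :: "nat \<Rightarrow> nat \<Rightarrow> nat \<Rightarrow> real \<Rightarrow> nat \<times> nat \<times> nat list \<Rightarrow> (nat \<times> nat \<Rightarrow> real) set" where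
  "envy_event n m t y = (\<lambda>(i, j, gs). {\<xi> \<in> space (util_space f n m).
     exp (- 3 * real t) \<le> pair_pot (1 - y) (real t / y) (real t) i j gs \<xi>})"

lemma measurable_prod_column_pot:
  assumes "j < n" "B \<subseteq> {..<n}"
  shows "(\<lambda>\<xi>. \<Prod>g<m. column_pot x y z n j B g \<xi>) \<in> borel_measurable (util_space f n m)"
  unfolding util_space_def using assms by (intro borel_measurable_prod measurable_column_pot) auto

lemma sets_depletion_event:
  "jB \<in> depletion_index n \<Longrightarrow> depletion_event n m r x y jB \<in> sets (util_space f n m)"
proof -
  assume "jB \<in> depletion_index n"
  then obtain j B where jB: "jB = (j, B)" "j < n" "B \<subseteq> {..<n}" by (auto simp: depletion_index_def)
  note [measurable] = measurable_prod_column_pot[OF jB(2,3)]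
  show ?thesis unfolding depletion_event_def jB(1) prod.case by measurable
qed

lemma sets_envy_event:
  "ijg \<in> envy_index n m t \<Longrightarrow> envy_event n m t y ijg \<in> sets (util_space f n m)"
proof -
  assume "ijg \<in> envy_index n m t"
  then obtain i j gs where *: "ijg = (i, j, gs)" "i < n" "j < n" "set gs \<subseteq> {..<m}"
    by (auto simp: envy_index_def)
  note [measurable] = measurable_pair_pot[OF *(2-4)]
  show ?thesis unfolding envy_event_def *(1) prod.case by measurable
qed

text \<open>Markov's inequality for the product potential. The bound is arranged as a factor for
  \<open>j\<close> alone times a power with exponent \<open>card B\<close>, ready for summation over
  \<open>B\<close>.\<close>

lemma prob_depletion_event:
  fixes x y p q :: real
  defines "p \<equiv> D.prob {1-x<..}" and "q \<equiv> D.prob {1-y<..}"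
  assumes jB: "(j, B) \<in> depletion_index n"
    and np: "real n * p \<le> 1/8" and q: "0 < q" "q \<le> 1/4"
  shows "measure (util_space f n m) (depletion_event n m r x y (j, B))
       \<le> 8 ^ r * exp (- (real m * q) / 4) *
          ((5 * q * (8 ^ r * exp (- (real m * p) / 4))) ^ card B * real (card B) ^ card B)"
proof -
  interpret prob_space "util_space f n m" by (rule prob_space_util)
  define k where "k = card B"
  define z where "z = hit_weight q B"
  have j: "j < n" "B \<subseteq> {..<n} - {j}" "B \<subseteq> {..<n}" using jB by (auto simp: depletion_index_def)
  have z1: "z \<ge> 1" by (simp add: z_def hit_weight_def)
  \<comment> \<open>If the maximum in the weight is not 1, then \<open>k * q * z\<close> is exactly
    \<open>1/5\<close>.\<close>
  have kqz: "real k * q * (z - 1) \<le> 1/5"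
  proof (cases "z = 1")
    case False
    hence "z = 1 / (5 * real k * q)"
      by (auto simp: z_def hit_weight_def k_def max_def split: if_splits)
    moreover have "k \<noteq> 0"
    proof
      assume "k = 0"
      thus False using False by (simp add: z_def hit_weight_def k_def)
    qed
    ultimately have "real k * q * (z - 1) = 1/5 - real k * q" using q by (simp add: field_simps)
    also have "\<dots> \<le> 1/5" using q by simp
    finally show ?thesis .
  qed simp
  have inv_z: "1 / z ^ k \<le> (5 * real k * q) ^ k"
  proof (cases "k = 0")
    case False
    have "1 / (5 * real k * q) \<le> z" by (simp add: z_def hit_weight_def k_def)
    hence "1 / z \<le> 5 * real k * q" using z1 q False by (simp add: field_simps)
    hence "(1 / z) ^ k \<le> (5 * real k * q) ^ k" using z1 by (intro power_mono) auto
    thus ?thesis by (simp add: power_divide)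
  qed simp
  have "prob (depletion_event n m r x y (j, B))
      \<le> exp (- (real m * (q + k * p)) / 4) / (z ^ k * (1/8) ^ ((k + 1) * r))"
    unfolding depletion_event_def prod.case k_def[symmetric] z_def[symmetric] q_def[symmetric]
  proof (rule markov_nn_integral)
    show "(\<integral>\<^sup>+ \<xi>. ennreal (\<Prod>g<m. column_pot x y z n j B g \<xi>) \<partial>util_space f n m)
        \<le> ennreal (exp (- (real m * (q + k * p)) / 4))"
      unfolding p_def q_def k_def
      by (rule nn_integral_prod_column_pot) (use j z1 np q kqz in \<open>auto simp: p_def q_def k_def\<close>)
  qed (use j z1 in \<open>auto intro: measurable_prod_column_pot\<close>)
  also have "\<dots> = (1 / z ^ k) * (8 ^ ((k + 1) * r) * exp (- (real m * (q + k * p)) / 4))"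
    by (simp add: power_divide k_def field_simps)
  also have "\<dots> \<le> (5 * real k * q) ^ k * (8 ^ ((k + 1) * r) * exp (- (real m * (q + k * p)) / 4))"
    by (intro mult_right_mono inv_z) auto
  also have "8 ^ ((k + 1) * r) = (8 ^ r * (8 ^ r) ^ k :: real)"
    by (simp add: power_add power_mult mult.commute flip: power_mult)
  also have "exp (- (real m * (q + k * p)) / 4) = exp (- (real m * q) / 4) * exp (- (real m * p) / 4) ^ k"
  proof -
    have "- (real m * (q + k * p)) / 4 = - (real m * q) / 4 + real k * (- (real m * p) / 4)"
      by (simp add: field_simps)
    thus ?thesis by (simp only: exp_add exp_of_nat_mult)
  qed
  finally show ?thesis by (simp add: k_def power_mult_distrib mult_ac)
qed

text \<open>Sets \<open>B\<close> are grouped by size \<open>k\<close>. The number of sets times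
  \<open>k ^ k\<close> is at most \<open>(exp 1 * n) ^ k\<close>, so \<open>\<rho>\<close> says that
  the resulting geometric series has ratio at most \<open>1/2\<close>, whence the factor 2.\<close>

lemma sum_prob_depletion_event:
  fixes x y p q :: real
  defines "p \<equiv> D.prob {1-x<..}" and "q \<equiv> D.prob {1-y<..}"
  assumes np: "real n * p \<le> 1/8" and q: "0 < q" "q \<le> 1/4"
    and \<rho>: "5 * exp 1 * real n * q * (8 ^ r * exp (- (real m * p) / 4)) \<le> 1/2"
  shows "(\<Sum>jB\<in>depletion_index n. measure (util_space f n m) (depletion_event n m r x y jB))
       \<le> 2 * real n * 8 ^ r * exp (- (real m * q) / 4)"
proof -
  define M where "M = 8 ^ r * exp (- (real m * p) / 4)"
  define c where "c = 8 ^ r * exp (- (real m * q) / 4)"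
  define h where "h = (\<lambda>k. c * ((5 * q * M) ^ k * real k ^ k))"
  have M0: "M \<ge> 0" and c0: "c \<ge> 0" by (auto simp: M_def c_def)
  have h0: "h k \<ge> 0" for k using M0 c0 q by (simp add: h_def)
  have "(\<Sum>jB\<in>depletion_index n. measure (util_space f n m) (depletion_event n m r x y jB))
      \<le> (\<Sum>jB\<in>depletion_index n. h (card (snd jB)))"
  proof (rule sum_mono)
    fix jB assume "jB \<in> depletion_index n"
    thus "measure (util_space f n m) (depletion_event n m r x y jB) \<le> h (card (snd jB))"
      using prob_depletion_event[of "fst jB" "snd jB" n x y m r] np q
      by (simp add: h_def c_def M_def p_def q_def)
  qed
  also have "\<dots> = (\<Sum>j<n. \<Sum>B\<in>Pow ({..<n} - {j}). h (card B))"
    unfolding depletion_index_def by (subst sum.Sigma) (auto intro!: sum.cong)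
  also have "\<dots> \<le> (\<Sum>j<n. 2 * c)"
  proof (rule sum_mono)
    fix j assume "j \<in> {..<n}"
    have "(\<Sum>B\<in>Pow ({..<n} - {j}). h (card B)) \<le> (\<Sum>B\<in>Pow {..<n}. h (card B))"
      by (intro sum_mono2) (auto simp: h0)
    also have "\<dots> = (\<Sum>k\<le>n. real (n choose k) * h k)" using sum_Pow_card[of "{..<n}" h] by simp
    also have "\<dots> \<le> (\<Sum>k\<le>n. c * (1/2) ^ k)"
    proof (rule sum_mono)
      fix k
      have "real (n choose k) * h k = c * ((5 * q * M) ^ k * (real (n choose k) * real k ^ k))"
        by (simp add: h_def)
      also have "\<dots> \<le> c * ((5 * q * M) ^ k * (exp 1 * real n) ^ k)"
        using c0 M0 q by (intro mult_left_mono binomial_mult_power_self_le) auto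
      also have "(5 * q * M) ^ k * (exp 1 * real n) ^ k = (5 * exp 1 * real n * q * M) ^ k"
        by (simp add: mult_ac flip: power_mult_distrib)
      also have "c * (5 * exp 1 * real n * q * M) ^ k \<le> c * (1/2) ^ k"
        using c0 M0 q \<rho> by (intro mult_left_mono power_mono) (auto simp: M_def)
      finally show "real (n choose k) * h k \<le> c * (1/2) ^ k" .
    qed
    also have "\<dots> = c * (\<Sum>k\<le>n. (1/2) ^ k)" by (simp add: sum_distrib_left)
    also have "c * (\<Sum>k\<le>n. (1/2) ^ k) \<le> c * 2"
    proof (rule mult_left_mono[OF _ c0])
      have "(\<Sum>k\<le>n. (1/2::real) ^ k) = (\<Sum>k<Suc n. (1/2) ^ k)" by (simp add: lessThan_Suc_atMost)
      also have "\<dots> \<le> 2" by (subst geometric_sum) auto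
      finally show "(\<Sum>k\<le>n. (1/2::real) ^ k) \<le> 2" .
    qed
    finally show "(\<Sum>B\<in>Pow ({..<n} - {j}). h (card B)) \<le> 2 * c" using c0 by (simp add: mult.commute)
  qed
  also have "\<dots> = 2 * real n * 8 ^ r * exp (- (real m * q) / 4)" by (simp add: c_def)
  finally show ?thesis .
qed

lemma prob_envy_event:
  assumes "ijg \<in> envy_index n m t" "0 < t" "0 < y"
  shows "measure (util_space f n m) (envy_event n m t y ijg) \<le> (4 * exp 3 * \<beta>\<^sup>2 * y / (real t)\<^sup>2) ^ t"
proof -
  interpret prob_space "util_space f n m" by (rule prob_space_util)
  obtain i j gs where *: "ijg = (i, j, gs)" "i < n" "j < n" "i \<noteq> j" "distinct gs" "set gs \<subseteq> {..<m}" "length gs = t"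
    using assms(1) by (auto simp: envy_index_def)
  let ?b = "(2 * \<beta> / (real t / y)) * (2 * \<beta> / real t)"
  have b0: "?b \<ge> 0" using assms \<beta>_pos by auto
  have "prob (envy_event n m t y ijg) \<le> ?b ^ t / exp (- 3 * real t)"
    unfolding envy_event_def *(1) prod.case
  proof (rule markov_nn_integral)
    show "(\<integral>\<^sup>+ \<xi>. ennreal (pair_pot (1 - y) (real t / y) (real t) i j gs \<xi>) \<partial>util_space f n m) \<le> ennreal (?b ^ t)"
      using nn_integral_pair_pot[OF *(2-4) _ _ *(5,6), of "real t / y" "real t" "1 - y"] assms b0 *(7)
      by (simp add: ennreal_power)
    show "0 \<le> ?b ^ t" using b0 by (rule zero_le_power)
  qed (use * measurable_pair_pot in auto)
  also have "\<dots> = (exp 3 * ?b) ^ t"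
    by (simp add: power_mult_distrib exp_minus field_simps flip: exp_of_nat_mult)
  also have "exp 3 * ?b = 4 * exp 3 * \<beta>\<^sup>2 * y / (real t)\<^sup>2"
    using assms by (simp add: field_simps power2_eq_square)
  finally show ?thesis .
qed

text \<open>There are at most \<open>m ^ t\<close> candidate lists, and each probability carries
  \<open>y ^ t\<close>. Only the product \<open>m * y\<close> remains, which is of order
  \<open>ln n\<close> for the later choice of \<open>y\<close>.\<close>

lemma sum_prob_envy_event:
  assumes "0 < t" "0 < y"
  shows "(\<Sum>ijg\<in>envy_index n m t. measure (util_space f n m) (envy_event n m t y ijg))
       \<le> (real n)\<^sup>2 * (4 * exp 3 * \<beta>\<^sup>2 * (real m * y) / (real t)\<^sup>2) ^ t"
proof -
  let ?b = "4 * exp 3 * \<beta>\<^sup>2 * y / (real t)\<^sup>2"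
  have b0: "?b \<ge> 0" using assms by auto
  have "(\<Sum>ijg\<in>envy_index n m t. measure (util_space f n m) (envy_event n m t y ijg))
      \<le> (\<Sum>ijg\<in>envy_index n m t. ?b ^ t)"
    using assms by (intro sum_mono prob_envy_event) auto
  also have "\<dots> = real (card (envy_index n m t)) * ?b ^ t" by simp
  also have "\<dots> \<le> real (n * n * m ^ t) * ?b ^ t"
    using b0 by (intro mult_right_mono of_nat_mono card_envy_index) auto
  also have "\<dots> = (real n)\<^sup>2 * (real m * ?b) ^ t"
    by (simp only: power2_eq_square power_mult_distrib of_nat_mult of_nat_power mult_ac)
  also have "real m * ?b = 4 * exp 3 * \<beta>\<^sup>2 * (real m * y) / (real t)\<^sup>2" by (simp add: mult_ac)
  finally show ?thesis .
qed

text \<open>The good event is \<open>Q - (F1 \<union> F2)\<close>: utilities lie in the unit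
  interval, which is almost sure, and neither a depletion certificate nor an unlikely envy list
  occurs. It refers to utilities only and so covers every tie-breaking at once.\<close>

lemma ex_WEF_event:
  fixes x y p q C :: real
  defines "p \<equiv> D.prob {1-x<..}" and "q \<equiv> D.prob {1-y<..}"
  assumes t: "0 < t" and r: "1 + C * real t \<le> real r" and y: "0 < y" and C: "1 \<le> C"
    and m: "real n * (1 + C * real t) < real m"
    and w: "\<forall>i<n. 0 < w i" "\<forall>i<n. \<forall>j<n. w i \<le> C * w j"
    and np: "real n * p \<le> 1/8" and q: "0 < q" "q \<le> 1/4"
    and \<rho>: "5 * exp 1 * real n * q * (8 ^ r * exp (- (real m * p) / 4)) \<le> 1/2"
  shows "\<exists>E \<in> sets (util_space f n m).
     1 - 2 * real n * 8 ^ r * exp (- (real m * q) / 4)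
       - (real n)\<^sup>2 * (4 * exp 3 * \<beta>\<^sup>2 * (real m * y) / (real t)\<^sup>2) ^ t \<le> measure (util_space f n m) E \<and>
     (\<forall>\<omega>\<in>E. \<forall>A. wps_outcome n m w (util_of \<omega>) A \<longrightarrow> WEF n w (util_of \<omega>) A)"
proof -
  let ?P = "util_space f n m"
  interpret prob_space ?P by (rule prob_space_util)
  define Q where "Q = {\<xi> \<in> space ?P. \<forall>c\<in>{..<n} \<times> {..<m}. \<xi> c \<in> {0..1}}"
  define F1 where "F1 = (\<Union>jB\<in>depletion_index n. depletion_event n m r x y jB)"
  define F2 where "F2 = (\<Union>ijg\<in>envy_index n m t. envy_event n m t y ijg)"
  have Q_sets: "Q \<in> sets ?P"
  proof -
    have "Measurable.pred ?P (\<lambda>\<xi>. \<xi> c \<in> {0..1})" if "c \<in> {..<n} \<times> {..<m}" for c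
    proof -
      have "(\<lambda>\<xi>. \<xi> c) \<in> borel_measurable ?P"
        using that measurable_util_component[of "fst c" n "snd c" m] by auto
      thus ?thesis by measurable
    qed
    hence "Measurable.pred ?P (\<lambda>\<xi>. \<forall>c\<in>{..<n} \<times> {..<m}. \<xi> c \<in> {0..1})"
      by (intro pred_intros_finite) auto
    thus ?thesis unfolding Q_def pred_def .
  qed
  have "AE \<xi> in ?P. \<forall>c\<in>{..<n} \<times> {..<m}. \<xi> c \<in> {0..1}"
    unfolding util_space_def
    by (intro AE_finite_allI AE_PiM_component prob_space_D AE_D_unit) auto
  hence Q1: "prob Q = 1"
    unfolding Q_def by (subst prob_Collect_eq_1) (use Q_sets in \<open>auto simp: Q_def\<close>)
  have F1: "F1 \<in> sets ?P" "prob F1 \<le> 2 * real n * 8 ^ r * exp (- (real m * q) / 4)"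
  proof -
    show "F1 \<in> sets ?P" unfolding F1_def
      by (intro sets.finite_UN finite_depletion_index sets_depletion_event)
    have "prob F1 \<le> (\<Sum>jB\<in>depletion_index n. prob (depletion_event n m r x y jB))"
      unfolding F1_def by (intro measure_UNION_le finite_depletion_index sets_depletion_event)
    also have "\<dots> \<le> 2 * real n * 8 ^ r * exp (- (real m * q) / 4)"
      unfolding q_def by (rule sum_prob_depletion_event) (use np q \<rho> in \<open>auto simp: p_def q_def\<close>)
    finally show "prob F1 \<le> 2 * real n * 8 ^ r * exp (- (real m * q) / 4)" .
  qed
  have F2: "F2 \<in> sets ?P" "prob F2 \<le> (real n)\<^sup>2 * (4 * exp 3 * \<beta>\<^sup>2 * (real m * y) / (real t)\<^sup>2) ^ t"
  proof -
    show "F2 \<in> sets ?P" unfolding F2_def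
      by (intro sets.finite_UN finite_envy_index sets_envy_event)
    have "prob F2 \<le> (\<Sum>ijg\<in>envy_index n m t. prob (envy_event n m t y ijg))"
      unfolding F2_def by (intro measure_UNION_le finite_envy_index sets_envy_event)
    also have "\<dots> \<le> (real n)\<^sup>2 * (4 * exp 3 * \<beta>\<^sup>2 * (real m * y) / (real t)\<^sup>2) ^ t"
      by (rule sum_prob_envy_event[OF t y])
    finally show "prob F2 \<le> (real n)\<^sup>2 * (4 * exp 3 * \<beta>\<^sup>2 * (real m * y) / (real t)\<^sup>2) ^ t" .
  qed
  show ?thesis
  proof (intro bexI conjI ballI allI impI)
    show E: "Q - (F1 \<union> F2) \<in> sets ?P" using Q_sets F1 F2 by auto
    have "1 = prob Q" using Q1 by simp
    also have "\<dots> \<le> prob ((Q - (F1 \<union> F2)) \<union> (F1 \<union> F2))"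
      using E F1(1) F2(1) by (intro finite_measure_mono sets.Un) auto
    also have "\<dots> \<le> prob (Q - (F1 \<union> F2)) + prob (F1 \<union> F2)"
      using E F1 F2 by (intro measure_Un_le) auto
    also have "prob (F1 \<union> F2) \<le> prob F1 + prob F2"
      using F1 F2 by (intro measure_Un_le) auto
    finally show "1 - 2 * real n * 8 ^ r * exp (- (real m * q) / 4)
       - (real n)\<^sup>2 * (4 * exp 3 * \<beta>\<^sup>2 * (real m * y) / (real t)\<^sup>2) ^ t \<le> prob (Q - (F1 \<union> F2))"
      using F1(2) F2(2) by linarith
  next
    fix \<omega> A assume \<omega>: "\<omega> \<in> Q - (F1 \<union> F2)" and out: "wps_outcome n m w (util_of \<omega>) A"
    have sp: "\<omega> \<in> space ?P" using \<omega> by (auto simp: Q_def)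
    have wpos: "\<And>a. a < n \<Longrightarrow> 0 < w a" and wC: "\<And>a b. a < n \<Longrightarrow> b < n \<Longrightarrow> w a \<le> C * w b"
      using w by auto
    have reach: "wps_reach n m w (util_of \<omega>) A" using out by (simp add: wps_outcome_def)
    have unit: "0 \<le> util_of \<omega> a g \<and> util_of \<omega> a g \<le> 1" if "a < n" "g < m" for a g
      using \<omega> that by (auto simp: Q_def util_of_def)
    have no_cert: "(\<Prod>g<m. column_pot x y (hit_weight q B) n j B g \<omega>)
        < hit_weight q B ^ card B * (1/8) ^ ((card B + 1) * r)" if "j < n" "B \<subseteq> {..<n} - {j}" for j B
    proof -
      have "(j, B) \<in> depletion_index n" using that by (simp add: depletion_index_def)
      hence "\<omega> \<notin> depletion_event n m r x y (j, B)" using \<omega> by (auto simp: F1_def)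
      thus ?thesis using sp by (simp add: depletion_event_def q_def not_le)
    qed
    have high: "1 - y < util_of \<omega> j g"
      if "wps_reach n m w (util_of \<omega>) A'" "card (A' j) \<le> t" "g \<in> A' j" "j < n" for A' j g
    proof -
      \<comment> \<open>While \<open>j\<close> has at most \<open>t\<close> picks, the pace of the
        algorithm limits everybody to \<open>1 + C * t\<close> picks. This is where \<open>r\<close>
        comes from.\<close>
      have "card (A' a) \<le> r" if "a < n" for a
      proof -
        have "real (card (A' a)) \<le> 1 + C * real (card (A' j))"
          by (rule wps_reach_card_le) (use \<open>wps_reach _ _ _ _ A'\<close> wpos wC that \<open>j < n\<close> in auto)
        also have "\<dots> \<le> 1 + C * real t" using \<open>card (A' j) \<le> t\<close> C by (intro add_left_mono mult_left_mono) auto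
        also have "\<dots> \<le> real r" by (rule r)
        finally show ?thesis by simp
      qed
      thus ?thesis
        using wps_reach_picks_high[OF that(1) _ _ no_cert that(4,3)] by (simp add: hit_weight_def util_of_def)
    qed
    show "WEF n w (util_of \<omega>) A"
      unfolding WEF_def
    proof (intro allI impI)
      fix i j assume ij: "i < n" "j < n"
      show "sum (util_of \<omega> i) (A j) / w j \<le> sum (util_of \<omega> i) (A i) / w i"
      proof (cases "i = j")
        case False
        show ?thesis
        proof (rule ccontr)
          assume "\<not> ?thesis"
          hence envy: "sum (util_of \<omega> i) (A i) / w i < sum (util_of \<omega> i) (A j) / w j" by simp
          \<comment> \<open>The lower bound on \<open>m\<close> guarantees that \<open>j\<close>
            made at least \<open>t\<close> picks, so that an envy list of length \<open>t\<close>
            exists.\<close>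
          have "real n * (1 + C * real t) < real n * (1 + C * real (card (A j)))"
            using m wps_outcome_card_ge[OF out wpos wC ij(2)] by linarith
          hence tj: "t \<le> card (A j)" using C ij by (simp add: mult_less_cancel_left_pos)
          show False
          proof (rule wps_reach_envy_list[where t=t and y=y, OF reach ij False])
            fix gs
            assume gs: "length gs = t" "distinct gs" "set gs \<subseteq> {..<m}"
              "dev (next_or (1 - y)) (map (util_of \<omega> j) gs) \<le> y" "dev max_list0 (map (util_of \<omega> i) gs) \<le> 2"
            have "real t / y * dev (next_or (1 - y)) (map (util_of \<omega> j) gs) \<le> real t / y * y"
              using gs(4) y by (intro mult_left_mono) auto
            moreover have "real t * dev max_list0 (map (util_of \<omega> i) gs) \<le> real t * 2"
              using gs(5) by (intro mult_left_mono) auto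
            ultimately have "exp (- 3 * real t) \<le> exp (- (real t / y) * dev (next_or (1 - y)) (map (util_of \<omega> j) gs)
                + - real t * dev max_list0 (map (util_of \<omega> i) gs))"
              using y by simp
            also have "\<dots> = pair_pot (1 - y) (real t / y) (real t) i j gs \<omega>"
              using util_of_row[of \<omega> i] util_of_row[of \<omega> j] by (simp only: pair_pot_def exp_add)
            finally have "\<omega> \<in> envy_event n m t y (i, j, gs)"
              using sp by (simp add: envy_event_def)
            moreover have "(i, j, gs) \<in> envy_index n m t" using gs ij False by (simp add: envy_index_def)
            ultimately show False using \<omega> by (auto simp: F2_def)
          qed (use wpos unit high[OF _ _ _ ij(2)] y tj envy in auto)
        qed
      qed simp
    qed
  qed
qed

text \<open>The scale is \<open>l = ln n / ln (ln n)\<close>: \<open>t\<close> and \<open>r\<close>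
  are of order \<open>l\<close>, an agent has at least \<open>16 * r\<close> expected top items
  (above \<open>1 - x\<close>) and at least \<open>16 * ln n\<close> expected favourites (above
  \<open>1 - y\<close>). The factor 16 in \<open>a\<close> leaves \<open>exp (- 4 * r)\<close> and
  \<open>exp (- 4 * ln n)\<close> after the loss of a factor 4 in the potential bound.\<close>

lemma ex_WEF_event_large:
  fixes C \<epsilon> :: real
  defines "a \<equiv> 16 / \<alpha>"
  assumes C: "C \<ge> 1" and n: "1 \<le> ln (ln (real n))" "36 * C \<le> ln (ln (real n))"
     "1 \<le> ln (real n) / ln (ln (real n))" "ln (ln (real n)) / real n \<le> 1"
     "ln (ln (real n)) * exp (- (ln (real n) / ln (ln (real n)))) \<le> 1/2"
     "(exp 3 * \<beta>\<^sup>2 * a / 16) * ((ln (ln (real n)))\<^sup>2 / ln (real n)) \<le> exp (- ln (ln (real n)) / 2)"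
     "3 / (real n)\<^sup>2 \<le> \<epsilon>" "1 \<le> 1 * real n" "0 < n"
    and m: "96 * a * \<beta> * C * real n * ln (real n) / ln (ln (real n)) \<le> real m"
    and w: "\<forall>i<n. 0 < w i" "\<forall>i<n. \<forall>j<n. w i \<le> C * w j"
  shows "\<exists>E \<in> sets (util_space f n m). 1 - \<epsilon> \<le> measure (util_space f n m) E \<and>
     (\<forall>\<omega>\<in>E. \<forall>A. wps_outcome n m w (util_of \<omega>) A \<longrightarrow> WEF n w (util_of \<omega>) A)"
proof -
  define L where "L = ln (real n)"
  define LL where "LL = ln L"
  define l where "l = L / LL"
  \<comment> \<open>The 8 turns \<open>exp (- LL / 2) ^ t\<close> into at most
    \<open>exp (- 4 * L)\<close>, that is \<open>1 / n ^ 4\<close>.\<close>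
  define t where "t = nat \<lceil>8 * l\<rceil>"
  define r where "r = nat \<lceil>1 + C * real t\<rceil>"
  define x where "x = a * real r / real m"
  define y where "y = a * L / real m"
  define p where "p = D.prob {1-x<..}"
  define q where "q = D.prob {1-y<..}"
  note n' = n[folded L_def, folded LL_def, folded l_def]
  have a0: "a > 0" using \<alpha>_pos by (simp add: a_def)
  have a\<alpha>: "a * \<alpha> = 16" using \<alpha>_pos by (simp add: a_def)
  have a\<beta>: "a * \<beta> \<ge> 16" using mult_left_mono[OF \<alpha>_le_\<beta>, of a] a0 a\<alpha> by simp
  have n0: "real n > 0" using n by simp
  have LL1: "LL \<ge> 1" and l1: "l \<ge> 1" using n' by auto
  have L0: "L > 0"
  proof -
    have "0 < l * LL" using LL1 l1 by simp
    thus ?thesis using LL1 by (simp add: l_def)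
  qed
  have L_eq: "L = l * LL" using LL1 by (simp add: l_def)
  have t: "8 * l \<le> real t" "real t \<le> 9 * l"
    using l1 by (auto simp: t_def) linarith
  have r: "1 + C * real t \<le> real r" "real r \<le> 12 * C * l"
  proof -
    show "1 + C * real t \<le> real r" using C by (simp add: r_def)
    have "real r \<le> 2 + C * real t"
    proof -
      have "0 \<le> 1 + C * real t" using C by simp
      thus ?thesis unfolding r_def by linarith
    qed
    also have "\<dots> \<le> 2 + C * (9 * l)" using t C by (intro add_left_mono mult_left_mono) auto
    also have "\<dots> \<le> 12 * C * l"
      using mult_mono[OF C l1] C by (simp add: algebra_simps)
    finally show "real r \<le> 12 * C * l" .
  qed
  have r_ge: "8 * l \<le> real r"
    using r(1) t(1) mult_right_mono[OF C, of "real t"] by simp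
  \<comment> \<open>Since \<open>r \<le> 12 * C * l\<close>, the constant \<open>96 = 8 * 12\<close>
    makes \<open>n * \<beta> * x\<close> at most \<open>1/8\<close>.\<close>
  define K where "K = 96 * a * \<beta> * C"
  have K0: "K > 0" using a0 \<beta>_pos C by (simp add: K_def)
  have m': "K * real n * l \<le> real m"
    using m by (simp add: K_def l_def LL_def L_def mult.assoc)
  have Knl: "0 < K * real n * l" using K0 n0 l1 by simp
  have m0: "0 < real m" using Knl m' by linarith
  have x0: "0 \<le> x" using a0 m0 by (simp add: x_def)
  have y0: "0 < y" using a0 m0 L0 by (simp add: y_def)
  have nx: "real n * \<beta> * x \<le> 1/8"
  proof -
    have "real n * \<beta> * x = real n * \<beta> * (a * real r) / real m" by (simp add: x_def)
    also have "\<dots> \<le> real n * \<beta> * (a * (12 * C * l)) / (K * real n * l)"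
      using m' Knl r(2) n0 \<beta>_pos a0 C l1 by (intro frac_le mult_left_mono) auto
    also have "\<dots> = 1/8" using n0 l1 a0 \<beta>_pos C by (simp add: K_def)
    finally show ?thesis .
  qed
  have ny: "real n * \<beta> * y \<le> LL / 96"
  proof -
    have "real n * \<beta> * y = real n * \<beta> * (a * L) / real m" by (simp add: y_def)
    also have "\<dots> \<le> real n * \<beta> * (a * L) / (K * real n * l)"
      using m' n0 \<beta>_pos a0 L0 mult_pos_pos[OF m0 Knl] by (intro divide_left_mono) auto
    also have "\<dots> = LL / (96 * C)" using n0 l1 a0 \<beta>_pos C LL1 by (simp add: K_def L_eq)
    also have "\<dots> \<le> LL / 96" using LL1 C by (intro divide_left_mono) auto
    finally show ?thesis .
  qed
  have \<beta>y: "\<beta> * y \<le> 1/96"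
  proof -
    have "\<beta> * y \<le> LL / real n / 96" using ny n0 by (simp add: field_simps)
    thus ?thesis using n'(4) by simp
  qed
  have y1: "y \<le> 1"
    using mult_right_mono[OF \<beta>_ge_1, of y] y0 \<beta>y by linarith
  have x1: "x \<le> 1"
  proof -
    have "1 \<le> real n * \<beta>" using n(8) \<beta>_ge_1 mult_mono[of 1 "real n" 1 \<beta>] by simp
    thus ?thesis using mult_right_mono[of 1 "real n * \<beta>" x] x0 nx by simp
  qed
  have p: "p \<le> \<beta> * x" "\<alpha> * x \<le> p" unfolding p_def using D_upper_tail[OF x0 x1] by auto
  have q: "q \<le> \<beta> * y" "\<alpha> * y \<le> q" unfolding q_def using D_upper_tail[of y] y0 y1 by auto
  have mp: "16 * real r \<le> real m * p"
  proof -
    have "16 * real r = real m * (\<alpha> * x)" using a\<alpha> m0 by (simp add: x_def mult_ac)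
    also have "\<dots> \<le> real m * p" using p by (intro mult_left_mono) auto
    finally show ?thesis .
  qed
  have mq: "16 * L \<le> real m * q"
  proof -
    have "16 * L = real m * (\<alpha> * y)" using a\<alpha> m0 by (simp add: y_def mult_ac)
    also have "\<dots> \<le> real m * q" using q by (intro mult_left_mono) auto
    finally show ?thesis .
  qed
  have pow8: "(8::real) ^ r \<le> exp (3 * real r)"
  proof -
    have "(8::real) = 2 ^ 3" by simp
    also have "\<dots> \<le> exp 1 ^ 3" using exp_ge_add_one_self[of 1] by (intro power_mono) auto
    also have "\<dots> = exp 3" by (simp flip: exp_of_nat_mult)
    finally have "(8::real) ^ r \<le> exp 3 ^ r" by (intro power_mono) auto
    thus ?thesis by (simp add: mult.commute flip: exp_of_nat_mult)
  qed
  have exp_L: "exp (real k * L) = real n ^ k" for k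
    using n0 by (simp add: L_def exp_of_nat_mult)
  have \<rho>: "5 * exp 1 * real n * q * (8 ^ r * exp (- (real m * p) / 4)) \<le> 1/2"
  proof -
    \<comment> \<open>As 8 is at most \<open>exp 3\<close>, the penalties \<open>8 ^ r\<close> still
      lose against \<open>exp (- 4 * r)\<close>, leaving \<open>exp (- r)\<close>.\<close>
    have "8 ^ r * exp (- (real m * p) / 4) \<le> exp (3 * real r) * exp (- (4 * real r))"
      using mp by (intro mult_mono pow8) auto
    also have "\<dots> = exp (- real r)" by (simp flip: exp_add)
    also have "\<dots> \<le> exp (- l)" using r_ge l1 by simp
    finally have 1: "8 ^ r * exp (- (real m * p) / 4) \<le> exp (- l)" .
    have "real n * q \<le> real n * (\<beta> * y)" using q by (intro mult_left_mono) auto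
    hence 2: "real n * q \<le> LL / 96" using ny by simp
    have "exp 1 \<le> (3::real)" using exp_le by simp
    hence "5 * exp 1 * (real n * q) \<le> 15 * (LL / 96)"
      using 2 LL1 by (intro mult_mono) (auto simp: q_def)
    also have "\<dots> \<le> LL" using LL1 by simp
    finally have "5 * exp 1 * (real n * q) * (8 ^ r * exp (- (real m * p) / 4)) \<le> LL * exp (- l)"
      using LL1 by (intro mult_mono 1) auto
    also have "\<dots> \<le> 1/2" using n'(5) by simp
    finally show ?thesis by (simp add: mult.assoc)
  qed
  have bound1: "2 * real n * 8 ^ r * exp (- (real m * q) / 4) \<le> 2 / (real n)\<^sup>2"
  proof -
    have "3 * real r \<le> L"
    proof -
      have "3 * real r \<le> (36 * C) * l" using r(2) by simp
      also have "\<dots> \<le> LL * l" using n'(2) l1 by (intro mult_right_mono) auto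
      finally show ?thesis by (simp add: L_eq mult.commute)
    qed
    hence "(8::real) ^ r \<le> exp L" by (intro order.trans[OF pow8]) auto
    hence 8: "(8::real) ^ r \<le> real n" using exp_L[of 1] by simp
    have "exp (- (real m * q) / 4) \<le> exp (- (real 4 * L))" using mq by simp
    also have "\<dots> = 1 / real n ^ 4" unfolding exp_minus exp_L by (simp add: inverse_eq_divide)
    finally have "2 * real n * 8 ^ r * exp (- (real m * q) / 4) \<le> 2 * real n * real n * (1 / real n ^ 4)"
      using 8 by (intro mult_mono) auto
    also have "\<dots> = 2 / (real n)\<^sup>2" using n0 by (simp add: field_simps power2_eq_square power4_eq_xxxx)
    finally show ?thesis .
  qed
  have bound2: "(real n)\<^sup>2 * (4 * exp 3 * \<beta>\<^sup>2 * (real m * y) / (real t)\<^sup>2) ^ t \<le> 1 / (real n)\<^sup>2"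
  proof -
    \<comment> \<open>The base of the power is now a constant times \<open>L / t\<^sup>2\<close>,
      hence of order \<open>LL\<^sup>2 / L\<close>, and drops below \<open>exp (- LL / 2)\<close>.
      Its \<open>t\<close>-th power is at most \<open>1 / n ^ 4\<close>, which absorbs the number of
      pairs of agents.\<close>
    have my: "real m * y = a * L" using m0 by (simp add: y_def)
    have "4 * exp 3 * \<beta>\<^sup>2 * (real m * y) / (real t)\<^sup>2 \<le> 4 * exp 3 * \<beta>\<^sup>2 * (a * L) / (8 * l)\<^sup>2"
      unfolding my using t(1) l1 a0 L0 by (intro divide_left_mono power_mono mult_nonneg_nonneg) auto
    also have "\<dots> = (exp 3 * \<beta>\<^sup>2 * a / 16) * (LL\<^sup>2 / L)"
      using L0 LL1 by (simp add: l_def power2_eq_square field_simps)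
    also have "\<dots> \<le> exp (- LL / 2)" using n'(6) by simp
    finally have "(4 * exp 3 * \<beta>\<^sup>2 * (real m * y) / (real t)\<^sup>2) ^ t \<le> exp (- LL / 2) ^ t"
      unfolding my using a0 L0 by (intro power_mono) auto
    also have "\<dots> = exp (- (real t * LL / 2))" by (simp flip: exp_of_nat_mult)
    also have "\<dots> \<le> exp (- (real 4 * L))"
    proof -
      have "8 * l * LL \<le> real t * LL" using t(1) LL1 by (intro mult_right_mono) auto
      thus ?thesis by (simp add: L_eq)
    qed
    also have "\<dots> = 1 / real n ^ 4" unfolding exp_minus exp_L by (simp add: inverse_eq_divide)
    finally have "(real n)\<^sup>2 * (4 * exp 3 * \<beta>\<^sup>2 * (real m * y) / (real t)\<^sup>2) ^ t \<le> (real n)\<^sup>2 * (1 / real n ^ 4)"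
      by (intro mult_left_mono) auto
    also have "\<dots> = 1 / (real n)\<^sup>2" using n0 by (simp add: field_simps power2_eq_square power4_eq_xxxx)
    finally show ?thesis .
  qed
  have t0: "0 < t" using t(1) l1 by (intro gr0I) auto
  have m_large: "real n * (1 + C * real t) < real m"
  proof -
    have "real n * (1 + C * real t) \<le> real n * (12 * C * l)"
      using r n0 by (intro mult_left_mono) auto
    also have "\<dots> = 12 * (C * real n * l)" by simp
    also have "\<dots> < 96 * (a * \<beta>) * (C * real n * l)"
    proof (rule mult_strict_right_mono)
      show "12 < 96 * (a * \<beta>)" using a\<beta> by linarith
    qed (use C n0 l1 in auto)
    also have "\<dots> \<le> real m" using m' by (simp add: K_def mult_ac)
    finally show ?thesis .
  qed
  have q_bounds: "0 < q" "q \<le> 1/4"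
  proof -
    have "0 < \<alpha> * y" using \<alpha>_pos y0 by simp
    thus "0 < q" using q by simp
    show "q \<le> 1/4" using q \<beta>y by simp
  qed
  have np: "real n * p \<le> 1/8"
    using mult_left_mono[OF p(1), of "real n"] nx by simp
  obtain E where E: "E \<in> sets (util_space f n m)"
     "1 - 2 * real n * 8 ^ r * exp (- (real m * q) / 4)
       - (real n)\<^sup>2 * (4 * exp 3 * \<beta>\<^sup>2 * (real m * y) / (real t)\<^sup>2) ^ t \<le> measure (util_space f n m) E"
     "\<forall>\<omega>\<in>E. \<forall>A. wps_outcome n m w (util_of \<omega>) A \<longrightarrow> WEF n w (util_of \<omega>) A"
    using ex_WEF_event[OF t0 r(1) y0 C m_large w np[unfolded p_def] q_bounds[unfolded q_def]
        \<rho>[unfolded p_def q_def]] unfolding q_def by blast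
  have "1 - \<epsilon> \<le> 1 - 2 / (real n)\<^sup>2 - 1 / (real n)\<^sup>2" using n(7) by (simp add: field_simps)
  thus ?thesis using E bound1 bound2 by (intro bexI[of _ E]) auto
qed

end

theorem theorem1:
  fixes f :: "real \<Rightarrow> real" and C :: real
  assumes "pdf_bounded f" and "C \<ge> 1"
  shows "\<exists>K>0. \<forall>\<epsilon>>0. \<exists>N. \<forall>n\<ge>N. \<forall>m (w :: nat \<Rightarrow> real).
           real m \<ge> K * real n * ln (real n) / ln (ln (real n)) \<and>
           (\<forall>i<n. w i > 0) \<and> (\<forall>i<n. \<forall>j<n. w i \<le> C * w j) \<longrightarrow>
           (\<exists>E \<in> sets (util_space f n m).
              measure (util_space f n m) E \<ge> 1 - \<epsilon> \<and>
              (\<forall>\<omega>\<in>E. \<forall>A. wps_outcome n m w (util_of \<omega>) A \<longrightarrow> WEF n w (util_of \<omega>) A))"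
proof -
  obtain \<alpha> \<beta> where "0 < \<alpha>" "\<forall>x\<in>{0..1}. \<alpha> \<le> f x \<and> f x \<le> \<beta>"
    using assms(1) by (auto simp: pdf_bounded_def)
  then interpret bounded_density f \<alpha> \<beta>
    using assms(1) by unfold_locales (auto simp: pdf_bounded_def)
  define a where "a = 16 / \<alpha>"
  have a0: "a > 0" using \<alpha>_pos by (simp add: a_def)
  show ?thesis
  \<comment> \<open>The constant depends only on the density bounds and on \<open>C\<close>. The
    tolerance \<epsilon> enters through \<open>N\<close> alone, and \<open>N\<close> is uniform in
    \<open>m\<close> and \<open>w\<close>.\<close>
  proof (intro exI[of _ "96 * a * \<beta> * C"] conjI allI impI)
    show "0 < 96 * a * \<beta> * C" using a0 \<beta>_pos assms(2) by simp
    fix \<epsilon> :: real assume "\<epsilon> > 0"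
    have "0 < exp 3 * \<beta>\<^sup>2 * a / 16" using a0 \<beta>_pos by simp
    from eventually_WEF_parameters[OF _ this \<open>\<epsilon> > 0\<close>, of C] assms(2)
    obtain N where N: "\<And>n. n \<ge> N \<Longrightarrow> 1 \<le> ln (ln (real n)) \<and> 36 * C \<le> ln (ln (real n)) \<and>
       1 \<le> ln (real n) / ln (ln (real n)) \<and> ln (ln (real n)) / real n \<le> 1 \<and>
       ln (ln (real n)) * exp (- (ln (real n) / ln (ln (real n)))) \<le> 1/2 \<and>
       (exp 3 * \<beta>\<^sup>2 * a / 16) * ((ln (ln (real n)))\<^sup>2 / ln (real n)) \<le> exp (- ln (ln (real n)) / 2) \<and>
       3 / (real n)\<^sup>2 \<le> \<epsilon> \<and> 0 < n"
      unfolding eventually_at_top_linorder by auto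
    show "\<exists>N. \<forall>n\<ge>N. \<forall>m (w :: nat \<Rightarrow> real).
           real m \<ge> 96 * a * \<beta> * C * real n * ln (real n) / ln (ln (real n)) \<and>
           (\<forall>i<n. w i > 0) \<and> (\<forall>i<n. \<forall>j<n. w i \<le> C * w j) \<longrightarrow>
           (\<exists>E \<in> sets (util_space f n m).
              measure (util_space f n m) E \<ge> 1 - \<epsilon> \<and>
              (\<forall>\<omega>\<in>E. \<forall>A. wps_outcome n m w (util_of \<omega>) A \<longrightarrow> WEF n w (util_of \<omega>) A))"
    proof (intro exI[of _ N] allI impI; elim conjE)
      fix n m w assume "N \<le> n" and "96 * a * \<beta> * C * real n * ln (real n) / ln (ln (real n)) \<le> real m"
        "\<forall>i<n. 0 < w i" "\<forall>i<n. \<forall>j<n. w i \<le> C * w j"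
      thus "\<exists>E \<in> sets (util_space f n m). 1 - \<epsilon> \<le> measure (util_space f n m) E \<and>
          (\<forall>\<omega>\<in>E. \<forall>A. wps_outcome n m w (util_of \<omega>) A \<longrightarrow> WEF n w (util_of \<omega>) A)"
        using N[OF \<open>N \<le> n\<close>] unfolding a_def
        by (intro ex_WEF_event_large[OF assms(2)]) auto
    qed
  qed
qed

end
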